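(* For every $i\in\{0,\dots,n\}$ there exists a bijection $\Phi$ from $\mathcal{P}^{\gg}_{c_{b_i}}$ to $\mathcal{P}_{i,\rho}\times\mathcal{P}$, where $\mathcal{P}$ is the set of ordinary integer partitions, such that if $\Phi(\lambda)=(\mu,\nu)$ then $|\lambda|=|\mu|+|\nu|$, $\ell(\lambda)=\ell(\mu)+\ell(\nu)$, and the product of the colours of the parts of $\lambda$ whose colour is not in $\{c_{b_k}:k\in\{0,\dots,n\}\}$ equals the corresponding product for $\mu$.
   Context: $\overline{[n]}=\{1,\dots,n,\overline n,\dots,\overline 1\}$ with order $1<\dots<n<\overline n<\dots<\overline 1$, $\overline{\overline k}=k$. $\mathcal{B}=\{\emptyset\}\sqcup\{(x,y):x\le y\in\overline{[n]}\}$; energy $H$: $H(\emptyset\otimes\emptyset)=0$, $H(\emptyset\otimes(x,y))=H((x,y)\otimes\emptyset)=1$, and for $x\le y$, $x'\le y'$, $H((x,y)\otimes(x',y'))=\chi(x\ge x')+\chi(y\ge y')-\chi(y\ge y'>x\ge x')$ if $\overline{y'}\ne x$ and $=\chi(x>x')+\chi(y>y')-\chi(y>y'>x>x')$ if $\overline{y'}=x$, where $\chi(P)\in\{0,1\}$ is the truth value of $P$. Colours are distinct formal symbols $c_b$ ($b\in\mathcal B$), written $c_{x,y}$ for $c_{(x,y)}$; coloured integers $k_c$ ($k\in\mathbb Z$). $b_0=\emptyset$, $b_k=(k,\overline k)$ for $k\ge1$. $\mathcal{P}^{\gg}_{c_{b_i}}$ is the set of finite sequences $(\pi_0,\dots,\pi_s)$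 of coloured integers with colours $c_b$ such that $\pi_s=0_{c_{b_i}}$, $\pi_{s-1}\ne0_{c_{b_i}}$ if $s>0$, and for $j<s$, writing $\pi_j=k_{c_b}$, $\pi_{j+1}=k'_{c_{b'}}$, $k-k'\ge H(b'\otimes b)$. Let $\mathcal S=\{c_{x,y}:x\le y\in\overline{[n]}\}$ and $c_\infty$ a new colour. Define $\rho_i$ on $\mathcal S\times(\mathcal S\sqcup\{c_\infty\})$ by $\rho_i(c_{b_i},c_\infty)=1$ (when $i\ge1$), $\rho_i(c_b,c_\infty)=H(b_i\otimes b)$ for $c_b\in\mathcal S\setminus\{c_{b_i}\}$, and $\rho_i(c_{x',y'},c_{x,y})=\chi(x\ge x')+\chi(y\ge y')-\chi(y\ge y'>x\ge x')$. $\tilde{\mathcal P}^{c_\infty}_{\rho_i}$ is the set of sequences $(\pi_0,\dots,\pi_{s-1},\pi_s=0_{c_\infty})$ with $c(\pi_j)\in\mathcal S$ for $j<s$ and $|\pi_j|-|\pi_{j+1}|\ge\rho_i(c(\pi_j),c(\pi_{j+1}))$ for all $j<s$; $\mathcal P_{i,\rho}$ is obtained from it by replacing the final part $0_{c_\infty}$ by $0_{c_{b_i}}$. For such sequences, $|\cdot|$ is the sum of sizes and $\ell(\cdot)$ the number of parts; for $\nu\in\mathcal P$ these are the usual size and number of parts. *)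

theory Defs
  imports "HOL-Library.Multiset"
begin

datatype letter = Unbarred nat | Barred nat

fun bar :: "letter \<Rightarrow> letter" where
  "bar (Unbarred k) = Barred k"
| "bar (Barred k) = Unbarred k"

(* 1 < 2 < ... < n < bar n < ... < bar 2 < bar 1, for all n simultaneously *)
instantiation letter :: linorder
begin

fun less_eq_letter :: "letter \<Rightarrow> letter \<Rightarrow> bool" where
  "Unbarred j \<le> Unbarred k \<longleftrightarrow> j \<le> k"
| "Unbarred j \<le> Barred k \<longleftrightarrow> True"
| "Barred j \<le> Unbarred k \<longleftrightarrow> False"
| "Barred j \<le> Barred k \<longleftrightarrow> k \<le> j"

definition less_letter :: "letter \<Rightarrow> letter \<Rightarrow> bool" where
  "x < y \<longleftrightarrow> x \<le> y \<and> \<not> y \<le> (x :: letter)"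

instance
proof
  fix x y z :: letter
  show "(x < y) = (x \<le> y \<and> \<not> y \<le> x)" by (rule less_letter_def)
  show "x \<le> x" by (cases x) auto
  show "x \<le> y \<Longrightarrow> y \<le> z \<Longrightarrow> x \<le> z" by (cases x; cases y; cases z) auto
  show "x \<le> y \<Longrightarrow> y \<le> x \<Longrightarrow> x = y" by (cases x; cases y) auto
  show "x \<le> y \<or> y \<le> x" by (cases x; cases y) auto
qed

end

definition letters :: "nat \<Rightarrow> letter set" where
  "letters n = Unbarred ` {1..n} \<union> Barred ` {1..n}"

datatype vertex = Empty | Vertex letter letter

definition crystal :: "nat \<Rightarrow> vertex set" where
  "crystal n = {Empty} \<union> {Vertex x y | x y. x \<in> letters n \<and> y \<in> letters n \<and> x \<le> y}"

(* H b b' is the energy of the tensor product of b and b', in this order *)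
fun H :: "vertex \<Rightarrow> vertex \<Rightarrow> int" where
  "H Empty Empty = 0"
| "H Empty (Vertex x y) = 1"
| "H (Vertex x y) Empty = 1"
| "H (Vertex x y) (Vertex x' y') =
     (if bar y' \<noteq> x
      then of_bool (x \<ge> x') + of_bool (y \<ge> y') - of_bool (y \<ge> y' \<and> y' > x \<and> x \<ge> x')
      else of_bool (x > x') + of_bool (y > y') - of_bool (y > y' \<and> y' > x \<and> x > x'))"

definition ground :: "nat \<Rightarrow> vertex" where
  "ground k = (if k = 0 then Empty else Vertex (Unbarred k) (Barred k))"

datatype colour = Colour vertex | Colour_infinity

(* the integer k of colour c is (k, c) *)
type_synonym coloured_int = "int \<times> colour"

definition grounded_partitions :: "nat \<Rightarrow> nat \<Rightarrow> coloured_int list set" where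
  "grounded_partitions n i = {\<pi>.
     \<pi> \<noteq> [] \<and>
     (\<forall>p \<in> set \<pi>. snd p \<in> Colour ` crystal n) \<and>
     last \<pi> = (0, Colour (ground i)) \<and>
     (length \<pi> > 1 \<longrightarrow> \<pi> ! (length \<pi> - 2) \<noteq> (0, Colour (ground i))) \<and>
     (\<forall>j k b k' b'. Suc j < length \<pi> \<longrightarrow> \<pi> ! j = (k, Colour b) \<longrightarrow> \<pi> ! Suc j = (k', Colour b') \<longrightarrow>
        k - k' \<ge> H b' b)}"

definition S_colours :: "nat \<Rightarrow> colour set" where
  "S_colours n = {Colour (Vertex x y) | x y. x \<in> letters n \<and> y \<in> letters n \<and> x \<le> y}"

(* only used when the first colour lies in S_colours n and the second one in S_colours n or is
   Colour_infinity *)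
fun \<rho> :: "nat \<Rightarrow> colour \<Rightarrow> colour \<Rightarrow> int" where
  "\<rho> i (Colour (Vertex x y)) Colour_infinity =
     (if Vertex x y = ground i then 1 else H (ground i) (Vertex x y))"
| "\<rho> i (Colour (Vertex x' y')) (Colour (Vertex x y)) =
     of_bool (x \<ge> x') + of_bool (y \<ge> y') - of_bool (y \<ge> y' \<and> y' > x \<and> x \<ge> x')"
| "\<rho> i _ _ = undefined"

definition \<rho>_partitions_infinity :: "nat \<Rightarrow> nat \<Rightarrow> coloured_int list set" where
  "\<rho>_partitions_infinity n i = {\<pi>.
     \<pi> \<noteq> [] \<and>
     last \<pi> = (0, Colour_infinity) \<and>
     (\<forall>j. Suc j < length \<pi> \<longrightarrow> snd (\<pi> ! j) \<in> S_colours n) \<and>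
     (\<forall>j. Suc j < length \<pi> \<longrightarrow>
        fst (\<pi> ! j) - fst (\<pi> ! Suc j) \<ge> \<rho> i (snd (\<pi> ! j)) (snd (\<pi> ! Suc j)))}"

definition \<rho>_partitions :: "nat \<Rightarrow> nat \<Rightarrow> coloured_int list set" where
  "\<rho>_partitions n i = (\<lambda>\<pi>. butlast \<pi> @ [(0, Colour (ground i))]) ` \<rho>_partitions_infinity n i"

definition weight :: "coloured_int list \<Rightarrow> int" where
  "weight \<pi> = sum_list (map fst \<pi>)"

(* Colours are commuting formal symbols, so a product of colours is an element of the free
   commutative monoid over them, i.e. a multiset. *)
definition colour_product :: "nat \<Rightarrow> coloured_int list \<Rightarrow> colour multiset" where
  "colour_product n \<pi> = {# c \<in># mset (map snd \<pi>). c \<notin> {Colour (ground k) | k. k \<in> {0..n}} #}"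

definition partitions :: "nat list set" where
  "partitions = {\<nu>. sorted_wrt (\<ge>) \<nu> \<and> (\<forall>k \<in> set \<nu>. k > 0)}"

end

theory Submission
  imports Defs
begin

text \<open>
  The bijection acts separately on each layer, that is, on the parts of a given size. Two
  consecutive parts of the same size have colours that strictly decrease in both coordinates, except
  that for the energy \<^term>\<open>H\<close> a ground colour may be repeated and may share a letter with its
  neighbours. In a layer the value of \<open>x\<close> relative to \<open>bar y\<close> decreases, so the layer is a list \<open>A\<close>
  of colours with \<open>bar y < x\<close>, then copies of a single ground colour, then a list \<open>B\<close> of colours with
  \<open>x < bar y\<close>. The ground colours that \<open>H\<close> allows between \<open>A\<close> and \<open>B\<close> are those allowed by \<open>\<rho>\<close>
  and exactly one more, which is \<^term>\<open>Empty\<close> for an empty layer. If the extra colour occurs, all its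
  copies become parts of the ordinary partition; if another ground colour occurs, all its copies but
  one do. The extra colour takes over the left letter of the top or the right letter of the bottom of
  its layer whenever it sits there, and the conditions between different layers only depend on these
  letters.
\<close>

section \<open>Ground colours inside a layer\<close>

lemma bar_bar [simp]: "bar (bar x) = x"
  by (cases x) auto

lemma less_letter_simps [simp]:
  "Unbarred j < Unbarred k \<longleftrightarrow> j < k"
  "Unbarred j < Barred k"
  "\<not> Barred j < Unbarred k"
  "Barred j < Barred k \<longleftrightarrow> k < j"
  by (auto simp: less_letter_def)

lemma bar_le_bar_iff [simp]: "bar x \<le> bar y \<longleftrightarrow> y \<le> x"
  by (cases x; cases y) auto

lemma bar_less_bar_iff [simp]: "bar x < bar y \<longleftrightarrow> y < x"
  by (cases x; cases y) auto

lemma bar_eq_bar_iff [simp]: "bar x = bar y \<longleftrightarrow> x = y"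
  by (cases x; cases y) auto

lemma bar_less_iff: "bar x < y \<longleftrightarrow> bar y < x"
  by (cases x; cases y) auto

lemma less_bar_iff: "x < bar y \<longleftrightarrow> y < bar x"
  by (cases x; cases y) auto

lemma bar_neq [simp]: "bar x \<noteq> x" "x \<noteq> bar x"
  by (cases x; simp)+

lemma bar_in_letters [simp]: "bar x \<in> letters n \<longleftrightarrow> x \<in> letters n"
  by (cases x) (auto simp: letters_def)

lemma less_bar_imp_le_bar: "x < bar y \<Longrightarrow> x \<le> y \<Longrightarrow> x \<le> bar x"
  by (cases x; cases y) auto

lemma le_bar_self_iff: "x \<le> bar x \<longleftrightarrow> (\<exists>k. x = Unbarred k)"
  by (cases x) auto

section \<open>Position of a colour relative to the ground colours\<close>

fun upper :: "vertex \<Rightarrow> bool" where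
  "upper Empty \<longleftrightarrow> False"
| "upper (Vertex x y) \<longleftrightarrow> bar y < x"

fun lower :: "vertex \<Rightarrow> bool" where
  "lower Empty \<longleftrightarrow> False"
| "lower (Vertex x y) \<longleftrightarrow> x < bar y"

fun neutral :: "vertex \<Rightarrow> bool" where
  "neutral Empty \<longleftrightarrow> True"
| "neutral (Vertex x y) \<longleftrightarrow> x = bar y"

fun strictly_above :: "vertex \<Rightarrow> vertex \<Rightarrow> bool" where
  "strictly_above (Vertex x' y') (Vertex x y) \<longleftrightarrow> x < x' \<and> y < y'"
| "strictly_above _ _ \<longleftrightarrow> False"

text \<open>The arguments swap because \<open>b\<close> colours the earlier part and the gap to the
  next part is \<open>H b' b\<close>; the relation says that both parts may have the same
  size.\<close>

abbreviation H_above :: "vertex \<Rightarrow> vertex \<Rightarrow> bool" where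
  "H_above b b' \<equiv> H b' b \<le> 0"

lemma vertex_trichotomy: "upper v \<or> neutral v \<or> lower v"
  by (cases v) auto

lemma upper_not: "upper v \<Longrightarrow> \<not> neutral v" "upper v \<Longrightarrow> \<not> lower v"
  by (cases v; auto)+

lemma lower_not: "lower v \<Longrightarrow> \<not> neutral v" "lower v \<Longrightarrow> \<not> upper v"
  by (cases v; auto)+

lemma neutral_not: "neutral v \<Longrightarrow> \<not> upper v" "neutral v \<Longrightarrow> \<not> lower v"
  by (cases v; auto)+

lemma Vertex_in_crystal [simp]:
  "Vertex x y \<in> crystal n \<longleftrightarrow> x \<in> letters n \<and> y \<in> letters n \<and> x \<le> y"
  by (auto simp: crystal_def)

lemma Empty_in_crystal [simp]: "Empty \<in> crystal n"
  by (auto simp: crystal_def)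

lemma H_above_Empty [simp]: "H_above b Empty \<longleftrightarrow> b = Empty" "H_above Empty b \<longleftrightarrow> b = Empty"
  by (cases b; simp)+

text \<open>The negative term of \<open>H\<close> is subtracted only if both indicators are 1, and
  then 1 remains. Hence \<open>H\<close> vanishes exactly if both indicators do.\<close>

lemma H_above_Vertex:
  assumes "x' \<le> y'" "x \<le> y"
  shows "H_above (Vertex x' y') (Vertex x y) \<longleftrightarrow>
    (if x = bar y' then x \<le> x' \<and> y \<le> y' else x < x' \<and> y < y')"
  using assms by (auto simp: of_bool_def H.simps(4))

declare H.simps(4) [simp del]

text \<open>Weak comparison needs the left letter of \<open>b'\<close> to be the bar of the right
  letter of \<open>b\<close>. Then equal left letters would make \<open>b\<close> neutral, and equal
  right letters would make \<open>b'\<close> neutral.\<close>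

lemma H_above_iff_strictly_above:
  assumes "b \<in> crystal n" "b' \<in> crystal n" "\<not> neutral b" "\<not> neutral b'"
  shows "H_above b b' \<longleftrightarrow> strictly_above b b'"
  using assms by (cases b; cases b') (auto simp: H_above_Vertex order_less_le)

text \<open>Going down a layer, the left letter cannot rise and the bar of the right letter cannot
  fall, which forces the order upper, neutral, lower. Two adjacent neutral colours squeeze their
  letters into equality.\<close>

lemma H_above_rank:
  assumes "b \<in> crystal n" "b' \<in> crystal n" "H_above b b'"
  shows "upper b' \<Longrightarrow> upper b" "neutral b' \<Longrightarrow> \<not> lower b" "neutral b' \<Longrightarrow> neutral b \<Longrightarrow> b' = b"
proof -
  show "upper b" if "upper b'"
  proof (cases b; cases b')
    fix x y x' y' assume "b = Vertex x y" "b' = Vertex x' y'"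
    with assms that have "x' \<le> x" "y' \<le> y" "bar y' < x'"
      by (auto simp: H_above_Vertex split: if_splits)
    then have "bar y \<le> bar y'" "bar y' < x'" "x' \<le> x" by auto
    then have "bar y < x" by (meson le_less_trans less_le_trans)
    then show ?thesis using \<open>b = _\<close> by simp
  qed (use assms that in auto)
  show "\<not> lower b" if "neutral b'"
  proof (cases b; cases b')
    fix x y x' y' assume "b = Vertex x y" "b' = Vertex x' y'"
    with assms that have "x' \<le> x" "y' \<le> y" "bar y' = x'"
      by (auto simp: H_above_Vertex split: if_splits)
    then have "bar y \<le> x" by (metis bar_le_bar_iff order_trans)
    then show ?thesis using \<open>b = _\<close> by simp
  qed (use assms that in auto)
  show "b' = b" if "neutral b'" "neutral b"
  proof (cases b; cases b')
    fix x y x' y' assume b: "b = Vertex x y" "b' = Vertex x' y'"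
    with assms that have "x' \<le> x" "y' \<le> y" "x' = bar y'" "x = bar y"
      by (auto simp: H_above_Vertex split: if_splits)
    then show ?thesis using b by (metis bar_le_bar_iff order_antisym)
  qed (use assms that in auto)
qed

section \<open>Layers, frames and slots\<close>

definition H_layers :: "nat \<Rightarrow> vertex list set" where
  "H_layers n = {D. set D \<subseteq> crystal n \<and> successively H_above D}"

definition strict_layers :: "nat \<Rightarrow> vertex list set" where
  "strict_layers n = {D. set D \<subseteq> crystal n - {Empty} \<and> successively strictly_above D}"

text \<open>The frame is what remains of a layer when its ground colours are deleted. The chain runs
  across the join, so that \<open>A @ B\<close> is itself a layer for both relations.\<close>

definition frame :: "nat \<Rightarrow> vertex list \<Rightarrow> vertex list \<Rightarrow> bool" where
  "frame n A B \<longleftrightarrow> set A \<subseteq> crystal n \<and> set B \<subseteq> crystal n \<and>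
     (\<forall>v \<in> set A. upper v) \<and> (\<forall>v \<in> set B. lower v) \<and> successively strictly_above (A @ B)"

definition weak_slot :: "nat \<Rightarrow> vertex list \<Rightarrow> vertex list \<Rightarrow> vertex \<Rightarrow> bool" where
  "weak_slot n A B b \<longleftrightarrow> b \<in> crystal n \<and> neutral b \<and>
     (A \<noteq> [] \<longrightarrow> H_above (last A) b) \<and> (B \<noteq> [] \<longrightarrow> H_above b (hd B))"

definition strict_slot :: "nat \<Rightarrow> vertex list \<Rightarrow> vertex list \<Rightarrow> vertex \<Rightarrow> bool" where
  "strict_slot n A B b \<longleftrightarrow> b \<in> crystal n - {Empty} \<and> neutral b \<and>
     (A \<noteq> [] \<longrightarrow> strictly_above (last A) b) \<and> (B \<noteq> [] \<longrightarrow> strictly_above b (hd B))"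

fun left :: "vertex \<Rightarrow> letter" where
  "left (Vertex x y) = x"
| "left Empty = undefined"

fun right :: "vertex \<Rightarrow> letter" where
  "right (Vertex x y) = y"
| "right Empty = undefined"

text \<open>
  The least letter that \<^term>\<open>H\<close> allows for the slot; it is excluded by \<^term>\<open>\<rho>\<close> because it
  shares a letter with a neighbour.
\<close>

definition extra :: "vertex list \<Rightarrow> vertex list \<Rightarrow> vertex" where
  "extra A B = (if A = [] \<and> B = [] then Empty else
     let a = (if A = [] then left (hd B) else if B = [] then bar (right (last A))
              else max (left (hd B)) (bar (right (last A))))
     in Vertex a (bar a))"

text \<open>The letters \<open>a\<close> that \<open>H\<close> allows form an interval closed at the
  lower end and open at the upper end. The interval for \<open>strictly_above\<close> is open with
  the same ends, and this is the source of the single extra colour.\<close>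

lemma H_above_neutral:
  assumes "x \<le> y" "a \<le> bar a"
  shows "bar y < x \<Longrightarrow> H_above (Vertex x y) (Vertex a (bar a)) \<longleftrightarrow> bar y \<le> a \<and> a < x"
    and "x < bar y \<Longrightarrow> H_above (Vertex a (bar a)) (Vertex x y) \<longleftrightarrow> x \<le> a \<and> a < bar y"
  using assms by (cases x; cases y; cases a; auto simp: H_above_Vertex)+

lemma strictly_above_neutral:
  "strictly_above (Vertex x y) (Vertex a (bar a)) \<longleftrightarrow> bar y < a \<and> a < x"
  "strictly_above (Vertex a (bar a)) (Vertex x y) \<longleftrightarrow> x < a \<and> a < bar y"
  by (auto simp: less_bar_iff bar_less_iff)

lemma neutral_cases:
  assumes "neutral b" "b \<in> crystal n"
  obtains "b = Empty" | a where "b = Vertex a (bar a)" "a \<in> letters n" "a \<le> bar a"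
  using assms by (cases b) auto

text \<open>The constraints from both sides intersect in intervals with the same ends, and the lower
  end is the letter of \<open>extra A B\<close>. The frame puts it strictly below the upper end, so
  only this colour makes a difference. For an empty frame the difference is
  \<open>Empty\<close>.\<close>

lemma weak_slot_iff:
  assumes "frame n A B"
  shows "weak_slot n A B b \<longleftrightarrow> strict_slot n A B b \<or> b = extra A B"
    and "\<not> strict_slot n A B (extra A B)"
proof -
  \<comment> \<open>The fact \<open>bar y \<le> y\<close> makes \<open>Vertex (bar y) y\<close>,
    which \<open>extra\<close> may choose, an element of the crystal.\<close>
  have A: "\<exists>x y. last A = Vertex x y \<and> x \<le> y \<and> bar y < x \<and> bar y \<le> y \<and> y \<in> letters n"
    if "A \<noteq> []"
  proof -
    have "last A \<in> crystal n" "upper (last A)"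
      using assms last_in_set[OF that] unfolding frame_def by blast+
    then show ?thesis by (cases "last A") (simp_all, meson less_le less_le_trans)
  qed
  have B: "\<exists>x y. hd B = Vertex x y \<and> x \<le> y \<and> x < bar y \<and> x \<le> bar x \<and> x \<in> letters n"
    if "B \<noteq> []"
  proof -
    have "hd B \<in> crystal n" "lower (hd B)"
      using assms hd_in_set[OF that] unfolding frame_def by blast+
    then show ?thesis by (cases "hd B") (simp_all add: less_bar_imp_le_bar)
  qed
  have AB: "strictly_above (last A) (hd B)" if "A \<noteq> []" "B \<noteq> []"
    using assms that by (auto simp: frame_def successively_append_iff)
  have ex: "extra A B \<in> crystal n" "neutral (extra A B)" "A \<noteq> [] \<or> B \<noteq> [] \<Longrightarrow> extra A B \<noteq> Empty"
    using A B by (auto simp: extra_def max_def Let_def)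
  \<comment> \<open>Both claims are bundled for neutral \<open>b\<close>, so that the second can be
    extracted at the end with \<open>extra A B\<close> in place of \<open>b\<close>.\<close>
  have **: "(weak_slot n A B b \<longleftrightarrow> strict_slot n A B b \<or> b = extra A B) \<and>
    \<not> strict_slot n A B (extra A B)" if b: "neutral b" "b \<in> crystal n" for b
  proof (cases "A = []"; cases "B = []")
    assume "A = []" "B = []"
    then show ?thesis
      using b by (auto simp: weak_slot_def strict_slot_def extra_def)
  next
    assume 1: "A = []" "B \<noteq> []"
    with B obtain x y where 2: "hd B = Vertex x y" "x \<le> y" "x < bar y" "x \<in> letters n" "x \<le> bar x"
      by blast
    from b show ?thesis
    proof (cases rule: neutral_cases)
      case (2 a)
      then show ?thesis using 1 \<open>hd B = _\<close> \<open>x \<le> y\<close> \<open>x < bar y\<close>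
        by (auto simp: weak_slot_def strict_slot_def extra_def H_above_neutral strictly_above_neutral
             simp del: strictly_above.simps)
    qed (use 1 2 in \<open>simp add: weak_slot_def strict_slot_def extra_def\<close>)
  next
    assume 1: "A \<noteq> []" "B = []"
    with A obtain x y where 2: "last A = Vertex x y" "x \<le> y" "bar y < x"
      by blast
    from b show ?thesis
    proof (cases rule: neutral_cases)
      case (2 a)
      then have "weak_slot n A B b \<longleftrightarrow> bar y \<le> a \<and> a < x"
        using 1 \<open>last A = _\<close> \<open>x \<le> y\<close> \<open>bar y < x\<close>
        by (auto simp: weak_slot_def H_above_neutral)
      moreover have "strict_slot n A B b \<longleftrightarrow> bar y < a \<and> a < x"
        using 1 2 \<open>last A = _\<close>
        by (auto simp: strict_slot_def strictly_above_neutral simp del: strictly_above.simps)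
      moreover have "b = extra A B \<longleftrightarrow> a = bar y"
        using 1 2 \<open>last A = _\<close> by (auto simp: extra_def)
      moreover have "\<not> strict_slot n A B (extra A B)"
        using 1 \<open>last A = _\<close> by (auto simp: strict_slot_def extra_def)
      ultimately show ?thesis using \<open>bar y < x\<close> by auto
    qed (use 1 2 in \<open>simp add: weak_slot_def strict_slot_def extra_def\<close>)
  next
    assume 1: "A \<noteq> []" "B \<noteq> []"
    with A obtain x y where 2: "last A = Vertex x y" "x \<le> y" "bar y < x"
      by blast
    from 1 B obtain x' y' where 3: "hd B = Vertex x' y'" "x' \<le> y'" "x' < bar y'"
      by blast
    \<comment> \<open>The chain across the join keeps both candidates for the maximum below both
      upper ends.\<close>
    have 4: "x' < x" "bar y < bar y'" using AB 1 2 3 by auto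
    have 5: "\<not> strict_slot n A B (extra A B)"
      using 1 2 3
      by (auto simp: strict_slot_def strictly_above_neutral extra_def Let_def max_def
           simp del: strictly_above.simps)
    from b show ?thesis
    proof (cases rule: neutral_cases)
      case (2 a)
      then have "weak_slot n A B b \<longleftrightarrow> max x' (bar y) \<le> a \<and> a < x \<and> a < bar y'"
        using 1 3 \<open>last A = _\<close> \<open>x \<le> y\<close> \<open>bar y < x\<close>
        by (auto simp: weak_slot_def H_above_neutral)
      moreover have "strict_slot n A B b \<longleftrightarrow> max x' (bar y) < a \<and> a < x \<and> a < bar y'"
        using 1 2 3 \<open>last A = _\<close>
        by (auto simp: strict_slot_def strictly_above_neutral simp del: strictly_above.simps)
      moreover have "b = extra A B \<longleftrightarrow> a = max x' (bar y)"
        using 1 2 3 \<open>last A = _\<close> by (auto simp: extra_def Let_def)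
      moreover have "max x' (bar y) < x" "max x' (bar y) < bar y'"
        using 3 4 \<open>bar y < x\<close> by auto
      ultimately show ?thesis using 5 by auto
    qed (use 1 2 3 5 ex in \<open>auto simp: weak_slot_def strict_slot_def\<close>)
  qed
  show "weak_slot n A B b \<longleftrightarrow> strict_slot n A B b \<or> b = extra A B"
  proof (cases "neutral b \<and> b \<in> crystal n")
    case False
    then show ?thesis using ex by (auto simp: weak_slot_def strict_slot_def)
  qed (use ** in blast)
  show "\<not> strict_slot n A B (extra A B)"
    using **[OF ex(2,1)] by blast
qed

lemma successively_strictly_above_iff:
  assumes "set D \<subseteq> crystal n" "\<forall>v \<in> set D. \<not> neutral v"
  shows "successively H_above D \<longleftrightarrow> successively strictly_above D"
  using assms by (intro successively_cong) (simp_all add: H_above_iff_strictly_above[of _ n] subset_iff)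

lemma strictly_above_imp_H_above:
  assumes "b \<in> crystal n" "b' \<in> crystal n" "strictly_above b b'"
  shows "H_above b b'"
  using assms by (cases b; cases b') (auto simp: H_above_Vertex)

text \<open>Colours are prepended one at a time. By \<open>H_above_rank\<close> a new colour that is
  not upper cannot precede an upper one, a lower one cannot precede a neutral one, and adjacent
  neutral ones coincide.\<close>

lemma layer_decomposition:
  assumes "set D \<subseteq> crystal n" "successively H_above D"
  obtains A B b g where "D = A @ replicate g b @ B" "\<forall>v \<in> set A. upper v" "\<forall>v \<in> set B. lower v"
    "g > 0 \<longrightarrow> neutral b"
  using assms
proof (induction D arbitrary: thesis)
  case Nil
  show ?case by (rule Nil(1)[of "[]" 0 _ "[]"]) auto
next
  case (Cons v D)
  then have sub: "set D \<subseteq> crystal n" "successively H_above D"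
    by (auto simp: successively_Cons)
  obtain A B b g where D: "D = A @ replicate g b @ B" "\<forall>v \<in> set A. upper v"
    "\<forall>v \<in> set B. lower v" "g > 0 \<longrightarrow> neutral b"
    using Cons.IH[OF _ sub] by blast
  have v: "H_above v (hd D)" "v \<in> crystal n" "hd D \<in> crystal n" if "D \<noteq> []"
    using Cons.prems that by (auto simp: successively_Cons)
  consider "upper v" | "neutral v" | "lower v"
    using vertex_trichotomy by blast
  then show ?case
  proof cases
    case 1
    then show ?thesis using D by (intro Cons.prems(1)[of "v # A" g b B]) auto
  next
    case 2
    have "A = []"
    proof (rule ccontr)
      assume "A \<noteq> []"
      then have "D \<noteq> []" "upper (hd D)" using D by auto
      with H_above_rank(1)[OF v(2,3,1)] 2 upper_not show False by blast
    qed
    show ?thesis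
    proof (cases "g = 0")
      case True
      then show ?thesis
        using D 2 \<open>A = []\<close> by (intro Cons.prems(1)[of "[]" 1 v B]) auto
    next
      case False
      then have "D \<noteq> []" "hd D = b" using D \<open>A = []\<close> by (cases g; auto)+
      then have "b = v" using H_above_rank(3)[OF v(2,3,1)] 2 D(4) False by auto
      then show ?thesis
        using D 2 \<open>A = []\<close> by (intro Cons.prems(1)[of "[]" "Suc g" v B]) auto
    qed
  next
    case 3
    have "A = []"
    proof (rule ccontr)
      assume "A \<noteq> []"
      then have "D \<noteq> []" "upper (hd D)" using D by auto
      with H_above_rank(1)[OF v(2,3,1)] 3 upper_not show False by blast
    qed
    moreover have "g = 0"
    proof (rule ccontr)
      assume "g \<noteq> 0"
      then have "D \<noteq> []" "neutral (hd D)" using D \<open>A = []\<close> by (cases g; auto)+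
      with H_above_rank(2)[OF v(2,3,1)] 3 show False by blast
    qed
    ultimately show ?thesis using D 3 by (intro Cons.prems(1)[of "[]" 0 b "v # B"]) auto
  qed
qed

lemma H_above_refl:
  assumes "neutral b" "b \<in> crystal n"
  shows "H_above b b"
  using assms by (cases b) (auto simp: H_above_Vertex)

lemma successively_replicate: "P b b \<Longrightarrow> successively P (replicate g b)"
  by (induction g) (auto simp: successively_Cons, metis hd_replicate)

text \<open>When ground colours separate \<open>A\<close> from \<open>B\<close>, the two are
  compared only through them. The half-open intervals give \<open>x' \<le> a < x\<close> and
  \<open>bar y \<le> a < bar y'\<close>, which combine to strict inequalities.\<close>

lemma weak_slot_imp_strictly_above:
  assumes "weak_slot n A B b" "\<forall>v \<in> set A. upper v" "\<forall>v \<in> set B. lower v"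
    "set A \<subseteq> crystal n" "set B \<subseteq> crystal n" "A \<noteq> []" "B \<noteq> []"
  shows "strictly_above (last A) (hd B)"
proof -
  have A: "last A \<in> crystal n" "upper (last A)" and B: "hd B \<in> crystal n" "lower (hd B)"
    using assms last_in_set hd_in_set by blast+
  obtain x y x' y' where xy: "last A = Vertex x y" "hd B = Vertex x' y'"
    using A B by (cases "last A"; cases "hd B") auto
  have "b \<noteq> Empty"
    using assms xy by (auto simp: weak_slot_def)
  then obtain a where "b = Vertex a (bar a)" "a \<le> bar a"
    using assms(1) by (auto simp: weak_slot_def elim!: neutral_cases)
  then have "bar y \<le> a" "a < x" "x' \<le> a" "a < bar y'"
    using assms(1,6,7) A B xy by (auto simp: weak_slot_def H_above_neutral)
  then have "x' < x" "bar y < bar y'"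
    by (blast intro: le_less_trans)+
  then show ?thesis using xy by simp
qed

lemma H_layers_cases:
  assumes "D \<in> H_layers n"
  obtains A B b g where "D = A @ replicate g b @ B" "frame n A B" "g > 0 \<longrightarrow> weak_slot n A B b"
proof -
  have D: "set D \<subseteq> crystal n" "successively H_above D"
    using assms by (auto simp: H_layers_def)
  then obtain A B b g where *: "D = A @ replicate g b @ B" "\<forall>v \<in> set A. upper v"
    "\<forall>v \<in> set B. lower v" "g > 0 \<longrightarrow> neutral b"
    by (rule layer_decomposition)
  have sub: "set A \<subseteq> crystal n" "set B \<subseteq> crystal n" "g > 0 \<Longrightarrow> b \<in> crystal n"
    using D(1) *(1) by auto
  have nn: "\<forall>v \<in> set A. \<not> neutral v" "\<forall>v \<in> set B. \<not> neutral v"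
    using *(2,3) upper_not(1) lower_not(1) by blast+
  have slot: "weak_slot n A B b" if "g > 0"
    using that D(2) sub(3) *(4) unfolding *(1)
    by (auto simp: weak_slot_def successively_append_iff hd_append)
  have "successively H_above A" "successively H_above B"
    using D(2) unfolding *(1) by (auto simp: successively_append_iff)
  then have ch: "successively strictly_above A" "successively strictly_above B"
    using successively_strictly_above_iff sub nn by blast+
  have "strictly_above (last A) (hd B)" if "A \<noteq> []" "B \<noteq> []"
  proof (cases "g = 0")
    case True
    then have "H_above (last A) (hd B)"
      using D(2) that unfolding *(1) by (auto simp: successively_append_iff)
    then show ?thesis
      using H_above_iff_strictly_above[of "last A" n "hd B"] that sub nn last_in_set hd_in_set by blast
  next
    case False
    then show ?thesis using weak_slot_imp_strictly_above[OF slot *(2,3) sub(1,2) that] by simp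
  qed
  with ch have "frame n A B"
    using sub *(2,3) by (auto simp: frame_def successively_append_iff)
  with * slot show thesis by (intro that[of A g b B]) auto
qed

lemma H_layersI:
  assumes "frame n A B" "g > 0 \<Longrightarrow> weak_slot n A B b"
  shows "A @ replicate g b @ B \<in> H_layers n"
proof -
  have sub: "set A \<subseteq> crystal n" "set B \<subseteq> crystal n"
    and s: "successively strictly_above (A @ B)"
    and nn: "\<forall>v \<in> set (A @ B). \<not> neutral v"
    using assms(1) upper_not(1) lower_not(1) by (auto simp: frame_def)
  have "successively H_above (A @ B)"
    using successively_strictly_above_iff[of "A @ B" n] sub s nn by auto
  then show ?thesis
    using assms(2) sub
    by (cases g) (auto simp: H_layers_def successively_append_iff weak_slot_def successively_Cons
      hd_append intro!: successively_replicate H_above_refl)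
qed

text \<open>A strict layer is also a layer for \<open>H\<close>, so the decomposition applies; a
  repeated ground colour is impossible because \<open>strictly_above\<close> is irreflexive.\<close>

lemma strict_layers_cases:
  assumes "D \<in> strict_layers n"
  obtains A B where "frame n A B" "D = A @ B"
    | A B b where "frame n A B" "strict_slot n A B b" "D = A @ b # B"
proof -
  have D: "set D \<subseteq> crystal n" "Empty \<notin> set D" "successively strictly_above D"
    using assms by (auto simp: strict_layers_def)
  then have "successively H_above D"
    by (auto elim!: successively_mono intro!: strictly_above_imp_H_above)
  with D have "D \<in> H_layers n" by (auto simp: H_layers_def)
  then obtain A B b g where *: "D = A @ replicate g b @ B" "frame n A B" "g > 0 \<longrightarrow> weak_slot n A B b"
    by (rule H_layers_cases)
  consider "g = 0" | "g = 1" | g' where "g = Suc (Suc g')"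
    by (metis One_nat_def not0_implies_Suc)
  then show thesis
  proof cases
    case 1
    then show thesis using * that by auto
  next
    case 2
    then have "strict_slot n A B b"
      using * D by (auto simp: strict_slot_def weak_slot_def successively_append_iff successively_Cons)
    then show thesis using * 2 by (intro that(2)[of A B b]) auto
  next
    case 3
    then have "strictly_above b b"
      using * D by (auto simp: successively_append_iff successively_Cons)
    then show thesis by (cases b) auto
  qed
qed

lemma strict_layersI:
  assumes "frame n A B"
  shows "A @ B \<in> strict_layers n" "strict_slot n A B b \<Longrightarrow> A @ b # B \<in> strict_layers n"
  using assms by (auto simp: frame_def strict_layers_def strict_slot_def successively_append_iff
      successively_Cons)

section \<open>Thinning a layer and its inverse\<close>

definition thin :: "vertex list \<Rightarrow> vertex list \<times> nat" where
  "thin D = (let A = filter upper D; G = filter neutral D; B = filter lower D in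
     if G = [] then (D, 0)
     else if hd G = extra A B then (A @ B, length G)
     else (A @ hd G # B, length G - 1))"

text \<open>A ground colour in \<open>C\<close> is the one copy that stayed behind, hence
  \<open>Suc f\<close>; its absence means that the \<open>f\<close> removed parts had the extra
  colour.\<close>

definition thick :: "vertex list \<times> nat \<Rightarrow> vertex list" where
  "thick = (\<lambda>(C, f). let A = filter upper C; G = filter neutral C; B = filter lower C in
     A @ (if G = [] then replicate f (extra A B) else replicate (Suc f) (hd G)) @ B)"

text \<open>The three filters recover the frame, so \<open>thin\<close> and \<open>thick\<close>
  need no choice of a decomposition.\<close>

lemma frame_filters:
  assumes "frame n A B"
  shows "filter upper A = A" "filter upper B = []" "filter neutral A = []" "filter neutral B = []"
    "filter lower A = []" "filter lower B = B"
  using assms upper_not lower_not by (auto simp: frame_def filter_empty_conv)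

lemma thin_simps:
  assumes "frame n A B"
  shows "thin (A @ B) = (A @ B, 0)"
    and "neutral b \<Longrightarrow> g > 0 \<Longrightarrow>
      thin (A @ replicate g b @ B) = (if b = extra A B then (A @ B, g) else (A @ b # B, g - 1))"
  using neutral_not[of b] by (auto simp: thin_def frame_filters[OF assms] Let_def)

lemma thick_simps:
  assumes "frame n A B"
  shows "thick (A @ B, f) = A @ replicate f (extra A B) @ B"
    and "neutral b \<Longrightarrow> thick (A @ b # B, f) = A @ replicate (Suc f) b @ B"
  using neutral_not[of b] by (auto simp: thick_def frame_filters[OF assms] Let_def)

lemma thin_cases:
  assumes "D \<in> H_layers n"
  obtains A B f where "frame n A B" "weak_slot n A B (extra A B)"
      "D = A @ replicate f (extra A B) @ B" "thin D = (A @ B, f)"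
    | A B b f where "frame n A B" "strict_slot n A B b"
      "D = A @ replicate (Suc f) b @ B" "thin D = (A @ b # B, f)"
proof -
  from assms obtain A B b g where *: "D = A @ replicate g b @ B" "frame n A B"
    "g > 0 \<longrightarrow> weak_slot n A B b"
    by (rule H_layers_cases)
  note slot = weak_slot_iff[OF *(2)]
  show thesis
  \<comment> \<open>A layer without ground colours counts as one with zero copies of the extra
    colour.\<close>
  proof (cases "g = 0 \<or> b = extra A B")
    case True
    then have "thin D = (A @ B, g)" "D = A @ replicate g (extra A B) @ B"
      using thin_simps(1)[OF *(2)] thin_simps(2)[OF *(2), of b g] * by (cases "g = 0"; auto simp: weak_slot_def)+
    then show thesis using * slot by (intro that(1)[of A B g]) auto
  next
    case False
    then have "thin D = (A @ b # B, g - 1)" "strict_slot n A B b" "Suc (g - 1) = g"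
      using thin_simps(1)[OF *(2)] thin_simps(2)[OF *(2), of b g] * slot by (auto simp: weak_slot_def)
    then show thesis using * by (intro that(2)[of A B b "g - 1"]) auto
  qed
qed

text \<open>Since \<open>extra A B\<close> is no strict slot, the two kinds of strict layers cannot
  be confused after thickening.\<close>

lemma thin_thick:
  assumes "C \<in> strict_layers n"
  shows "thick (C, f) \<in> H_layers n" "thin (thick (C, f)) = (C, f)"
proof -
  have "thick (C, f) \<in> H_layers n \<and> thin (thick (C, f)) = (C, f)"
    using assms
  proof (cases rule: strict_layers_cases)
    case (1 A B)
    then have "weak_slot n A B (extra A B)" using weak_slot_iff by blast
    with 1 show ?thesis
      using thin_simps(1)[OF 1(1)] thin_simps(2)[OF 1(1), of "extra A B" f] thick_simps[OF 1(1)] H_layersI[OF 1(1), of f "extra A B"]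
      by (cases "f = 0") (auto simp: weak_slot_def)
  next
    case (2 A B b)
    then have "weak_slot n A B b" "b \<noteq> extra A B" using weak_slot_iff by blast+
    with 2 show ?thesis
      using thin_simps(2)[OF 2(1), of b "Suc f"] thick_simps(2)[OF 2(1), of b f] H_layersI[OF 2(1), of "Suc f" b]
      by (auto simp: weak_slot_def)
  qed
  then show "thick (C, f) \<in> H_layers n" "thin (thick (C, f)) = (C, f)" by auto
qed

lemma thin_strict_layers: "D \<in> H_layers n \<Longrightarrow> fst (thin D) \<in> strict_layers n"
  by (erule thin_cases) (auto simp: strict_layersI)

lemma thick_thin:
  assumes "D \<in> H_layers n"
  shows "thick (thin D) = D"
  using assms
proof (cases rule: thin_cases)
  case (2 A B b f)
  then show ?thesis using thick_simps(2)[OF 2(1), of b f] by (auto simp: strict_slot_def)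
qed (auto simp: thick_simps)

lemma thin_length: "D \<in> H_layers n \<Longrightarrow> length D = length (fst (thin D)) + snd (thin D)"
  by (erule thin_cases) auto

lemma thin_not_neutral:
  "D \<in> H_layers n \<Longrightarrow> filter (\<lambda>v. \<not> neutral v) D = filter (\<lambda>v. \<not> neutral v) (fst (thin D))"
  by (erule thin_cases) (auto simp: weak_slot_def strict_slot_def)

lemma thin_zero: "D \<in> H_layers n \<Longrightarrow> snd (thin D) = 0 \<Longrightarrow> fst (thin D) = D"
  by (erule thin_cases) auto

section \<open>Letters at the two ends of a layer\<close>

fun left_letter :: "vertex \<Rightarrow> letter option" where
  "left_letter Empty = None"
| "left_letter (Vertex x y) = Some x"

fun right_letter :: "vertex \<Rightarrow> letter option" where
  "right_letter Empty = None"
| "right_letter (Vertex x y) = Some y"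

text \<open>\<open>None\<close> means that no condition arises. This suits an empty layer and
  equally the colour \<open>Empty\<close>, whose energy with any colour is at most 1.\<close>

definition top_letter :: "vertex list \<Rightarrow> letter option" where
  "top_letter D = (if D = [] then None else left_letter (hd D))"

definition bottom_letter :: "vertex list \<Rightarrow> letter option" where
  "bottom_letter D = (if D = [] then None else right_letter (last D))"

lemma frame_Vertex:
  assumes "frame n A B"
  shows "A \<noteq> [] \<Longrightarrow> last A \<noteq> Empty" "B \<noteq> [] \<Longrightarrow> hd B \<noteq> Empty"
  using assms last_in_set hd_in_set unfolding frame_def by (metis upper.simps(1), metis lower.simps(1))

text \<open>The extra colour can be at the top only if \<open>A\<close> is empty. Then its left
  letter is that of \<open>hd B\<close>, or else \<open>B\<close> is empty too and it is
  \<open>Empty\<close>, which has no letter, like the empty layer that remains.\<close>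

lemma thin_top_letter: "D \<in> H_layers n \<Longrightarrow> top_letter (fst (thin D)) = top_letter D"
proof (erule thin_cases)
  fix A B f assume *: "frame n A B" "D = A @ replicate f (extra A B) @ B" "thin D = (A @ B, f)"
  show "top_letter (fst (thin D)) = top_letter D"
    using * frame_Vertex[OF *(1)]
    by (cases "A = []"; cases "B = []"; cases f; cases "hd B")
      (auto simp: top_letter_def extra_def)
next
  fix A B b f assume *: "frame n A B" "D = A @ replicate (Suc f) b @ B" "thin D = (A @ b # B, f)"
  show "top_letter (fst (thin D)) = top_letter D"
    using * by (cases A) (auto simp: top_letter_def)
qed

text \<open>Dually, if \<open>B\<close> is empty and \<open>A\<close> is not, the right letter of
  the extra colour is that of \<open>last A\<close>.\<close>

lemma thin_bottom_letter: "D \<in> H_layers n \<Longrightarrow> bottom_letter (fst (thin D)) = bottom_letter D"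
proof (erule thin_cases)
  fix A B f assume *: "frame n A B" "D = A @ replicate f (extra A B) @ B" "thin D = (A @ B, f)"
  show "bottom_letter (fst (thin D)) = bottom_letter D"
    using * frame_Vertex[OF *(1)]
    by (cases "A = []"; cases "B = []"; cases f; cases "last A")
      (auto simp: bottom_letter_def extra_def last_append)
next
  fix A B b f assume *: "frame n A B" "D = A @ replicate (Suc f) b @ B" "thin D = (A @ b # B, f)"
  show "bottom_letter (fst (thin D)) = bottom_letter D"
    using * by (cases B) (auto simp: bottom_letter_def last_append)
qed

section \<open>Lists of parts and their layers\<close>

text \<open>The colour type is left open: vertices serve for coloured partitions, and
  \<open>unit\<close> for ordinary ones, whose layers then record only multiplicities.\<close>

definition layer :: "(int \<times> 'a) list \<Rightarrow> nat \<Rightarrow> 'a list" where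
  "layer \<pi> m = map snd (filter (\<lambda>p. fst p = int m) \<pi>)"

fun assemble :: "nat \<Rightarrow> (nat \<Rightarrow> 'a list) \<Rightarrow> (int \<times> 'a) list" where
  "assemble 0 L = []"
| "assemble (Suc N) L = map (Pair (int N)) (L N) @ assemble N L"

definition descending :: "(int \<times> 'a) list \<Rightarrow> bool" where
  "descending \<pi> \<longleftrightarrow> sorted_wrt (\<ge>) (map fst \<pi>) \<and> (\<forall>p \<in> set \<pi>. fst p \<ge> 0)"

definition finite_support :: "(nat \<Rightarrow> 'a list) \<Rightarrow> bool" where
  "finite_support L \<longleftrightarrow> (\<exists>N. \<forall>m\<ge>N. L m = [])"

lemma set_assemble: "p \<in> set (assemble N L) \<longleftrightarrow> (\<exists>m<N. fst p = int m \<and> snd p \<in> set (L m))"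
  by (induction N; cases p) (auto simp: less_Suc_eq)

lemma descending_assemble: "descending (assemble N L)"
proof (induction N)
  case (Suc N)
  have "sorted_wrt (\<ge>) (map fst (map (Pair (int N)) xs))" for xs :: "'a list"
    by (induction xs) auto
  with Suc show ?case
    by (auto simp: descending_def sorted_wrt_append set_assemble simp del: map_map)
qed (simp add: descending_def)

lemma layer_assemble: "layer (assemble N L) m = (if m < N then L m else [])"
  by (induction N) (auto simp: layer_def filter_map comp_def less_Suc_eq)

lemma assemble_Cons:
  assumes "m < N" "\<And>k. m < k \<Longrightarrow> L k = []"
  shows "assemble N (L(m := b # L m)) = (int m, b) # assemble N L"
proof -
  have "assemble m (L(m := x)) = assemble m L" for x
  proof -
    have "assemble k (L(m := x)) = assemble k L" if "k \<le> m" for k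
      using that by (induction k) auto
    then show ?thesis by simp
  qed
  with assms show ?thesis by (induction N) (auto simp: less_Suc_eq)
qed

lemma assemble_layer:
  assumes "descending \<pi>" "\<And>p. p \<in> set \<pi> \<Longrightarrow> fst p < int N"
  shows "assemble N (layer \<pi>) = \<pi>"
  using assms
proof (induction \<pi>)
  case Nil
  have "assemble N (\<lambda>m. []) = []" by (induction N) auto
  then show ?case by (simp add: layer_def)
next
  case (Cons p \<pi>)
  obtain m b where p: "p = (int m, b)"
    using Cons.prems by (cases p) (auto simp: descending_def elim: nonneg_int_cases)
  have "layer (p # \<pi>) = (layer \<pi>)(m := b # layer \<pi> m)"
    by (auto simp: layer_def p)
  moreover have "layer \<pi> k = []" if "m < k" for k
    using Cons.prems that by (auto simp: layer_def p descending_def filter_empty_conv)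
  moreover have "m < N" using Cons.prems(2)[of p] by (simp add: p)
  ultimately show ?case
    using Cons assemble_Cons[of m N "layer \<pi>" b] by (simp add: p descending_def del: fun_upd_apply)
qed

lemma bounded_fst: "\<exists>N. \<forall>p \<in> set (\<pi> :: (int \<times> 'a) list). fst p < int N"
proof (induction \<pi>)
  case (Cons p \<pi>)
  then obtain N where N: "\<forall>p \<in> set \<pi>. fst p < int N" by blast
  show ?case
    by (rule exI[of _ "N + nat (fst p + 1)"]) (use N in fastforce)
qed auto

lemma layer_eq_Nil: "\<forall>p \<in> set \<pi>. fst p < int N \<Longrightarrow> N \<le> m \<Longrightarrow> layer \<pi> m = []"
  by (force simp: layer_def filter_empty_conv)

text \<open>The inverse is \<open>assemble N\<close> for any \<open>N\<close> beyond the occurring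
  sizes. As no \<open>N\<close> serves all lists, it is chosen anew for each list or pair of
  lists.\<close>

lemma bij_betw_layer: "bij_betw layer {\<pi>. descending \<pi>} {L. finite_support L}"
proof (rule bij_betwI')
  fix \<pi> \<pi>' :: "(int \<times> 'a) list"
  assume *: "\<pi> \<in> {\<pi>. descending \<pi>}" "\<pi>' \<in> {\<pi>. descending \<pi>}"
  obtain N where "\<forall>p \<in> set (\<pi> @ \<pi>'). fst p < int N" using bounded_fst by blast
  then have "assemble N (layer \<pi>) = \<pi>" "assemble N (layer \<pi>') = \<pi>'"
    using * by (auto intro!: assemble_layer)
  then show "layer \<pi> = layer \<pi>' \<longleftrightarrow> \<pi> = \<pi>'" by metis
next
  fix \<pi> :: "(int \<times> 'a) list"
  show "layer \<pi> \<in> {L. finite_support L}"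
    using bounded_fst[of \<pi>] layer_eq_Nil unfolding finite_support_def by blast
next
  fix L :: "nat \<Rightarrow> 'a list" assume "L \<in> {L. finite_support L}"
  then obtain N where N: "\<forall>m\<ge>N. L m = []" by (auto simp: finite_support_def)
  have "L = layer (assemble N L)"
    using N by (auto simp: layer_assemble fun_eq_iff)
  then show "\<exists>\<pi> \<in> {\<pi>. descending \<pi>}. L = layer \<pi>"
    using descending_assemble by blast
qed

lemma length_assemble: "length (assemble N L) = (\<Sum>m<N. length (L m))"
  by (induction N) auto

lemma sum_assemble: "sum_list (map fst (assemble N L)) = (\<Sum>m<N. int m * int (length (L m)))"
proof -
  have "sum_list (map fst (map (Pair (int m)) xs)) = int m * int (length xs)" for m and xs :: "'a list"
    by (induction xs) (auto simp: algebra_simps)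
  then show ?thesis by (induction N) auto
qed

lemma hd_assemble:
  assumes "assemble N L \<noteq> []"
  shows "\<exists>m<N. hd (assemble N L) = (int m, hd (L m)) \<and> L m \<noteq> [] \<and> (\<forall>k. m < k \<longrightarrow> k < N \<longrightarrow> L k = [])"
  using assms
proof (induction N)
  case (Suc N)
  then show ?case
    by (cases "L N = []") (auto simp: hd_map less_Suc_eq)
qed auto

lemma last_assemble:
  assumes "assemble N L \<noteq> []"
  shows "\<exists>m<N. last (assemble N L) = (int m, last (L m)) \<and> L m \<noteq> [] \<and> (\<forall>k<m. L k = [])"
  using assms
proof (induction N)
  case (Suc N)
  show ?case
  proof (cases "assemble N L = []")
    case True
    then have "L k = []" if "k < N" for k
      using layer_assemble[of N L k] that by (simp add: layer_def)
    with Suc True show ?thesis by (auto simp: last_map)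
  next
    case False
    with Suc show ?thesis by (auto simp: less_Suc_eq)
  qed
qed auto

section \<open>Gap conditions in terms of layers\<close>

definition gap :: "('a \<Rightarrow> 'a \<Rightarrow> int) \<Rightarrow> int \<times> 'a \<Rightarrow> int \<times> 'a \<Rightarrow> bool" where
  "gap d p q \<longleftrightarrow> fst p - fst q \<ge> d (snd p) (snd q)"

text \<open>A gap bounded by 2 is automatic once the sizes differ by at least 2, so only equal and
  adjacent sizes leave a condition.\<close>

lemma successively_assemble:
  assumes d: "\<And>b c. b \<in> V \<Longrightarrow> c \<in> V \<Longrightarrow> 0 \<le> d b c \<and> d b c \<le> 2" and L: "\<And>m. set (L m) \<subseteq> V"
  shows "successively (gap d) (assemble N L) \<longleftrightarrow>
    (\<forall>m<N. successively (\<lambda>b c. d b c \<le> 0) (L m)) \<and>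
    (\<forall>m. Suc m < N \<longrightarrow> L (Suc m) \<noteq> [] \<longrightarrow> L m \<noteq> [] \<longrightarrow> d (last (L (Suc m))) (hd (L m)) \<le> 1)"
proof (induction N)
  case (Suc N)
  have map: "successively (gap d) (map (Pair (int N)) (L N)) \<longleftrightarrow> successively (\<lambda>b c. d b c \<le> 0) (L N)"
    by (simp add: successively_map gap_def)
  \<comment> \<open>The part after layer \<open>N\<close> lies in the highest nonempty layer
    \<open>m\<close> below it, which matters only if \<open>N = Suc m\<close>.\<close>
  have "(L N \<noteq> [] \<longrightarrow> assemble N L \<noteq> [] \<longrightarrow> gap d (int N, last (L N)) (hd (assemble N L))) \<longleftrightarrow>
    (\<forall>m. N = Suc m \<longrightarrow> L (Suc m) \<noteq> [] \<longrightarrow> L m \<noteq> [] \<longrightarrow> d (last (L (Suc m))) (hd (L m)) \<le> 1)"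
  proof (cases "L N \<noteq> [] \<and> assemble N L \<noteq> []")
    case True
    then obtain m where m: "m < N" "hd (assemble N L) = (int m, hd (L m))" "L m \<noteq> []"
      "\<forall>k. m < k \<longrightarrow> k < N \<longrightarrow> L k = []"
      using hd_assemble by blast
    have "d (last (L N)) (hd (L m)) \<le> 2"
      using d[of "last (L N)" "hd (L m)"] L True m(3) last_in_set hd_in_set by blast
    with True m show ?thesis
      by (cases "N = Suc m") (auto simp: gap_def)
  next
    case False
    have "assemble N L \<noteq> []" if "N = Suc m" "L m \<noteq> []" for m using that by simp
    with False show ?thesis by auto
  qed
  then show ?case
    using Suc map by (auto simp: successively_append_iff last_map less_Suc_eq)
qed auto

text \<open>By the same bound 2, the condition on the last part is a restriction only if its size is
  0 or 1.\<close>

lemma last_assemble_bound: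
  assumes e: "\<And>b. b \<in> V \<Longrightarrow> e b \<le> 2" and L: "\<And>m. set (L m) \<subseteq> V"
    and N: "\<forall>m\<ge>N. L m = []"
  shows "(assemble N L \<noteq> [] \<longrightarrow> fst (last (assemble N L)) \<ge> e (snd (last (assemble N L)))) \<longleftrightarrow>
    (L 0 \<noteq> [] \<longrightarrow> e (last (L 0)) \<le> 0) \<and> (L 0 = [] \<longrightarrow> L 1 \<noteq> [] \<longrightarrow> e (last (L 1)) \<le> (1 :: int))"
proof (cases "assemble N L = []")
  case True
  then have "L k = []" for k
    using layer_assemble[of N L k] N by (cases "k < N") (auto simp: layer_def)
  with True show ?thesis by simp
next
  case False
  then obtain m where m: "m < N" "last (assemble N L) = (int m, last (L m))" "L m \<noteq> []" "\<forall>k<m. L k = []"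
    using last_assemble by blast
  consider "m = 0" | "m = 1" | "m \<ge> 2" by linarith
  then show ?thesis
  proof cases
    case 3
    then have "L 0 = []" "L 1 = []" using m by auto
    moreover have "e (last (L m)) \<le> 2" using e L m(3) last_in_set by blast
    ultimately show ?thesis using 3 m by auto
  qed (use False m in auto)
qed

lemma descendingI:
  assumes d: "\<And>b c. b \<in> V \<Longrightarrow> c \<in> V \<Longrightarrow> 0 \<le> d b c" and V: "snd ` set \<pi> \<subseteq> V"
    and "successively (gap d) \<pi>" "\<pi> \<noteq> [] \<Longrightarrow> fst (last \<pi>) \<ge> 0"
  shows "descending \<pi>"
  using assms(2-)
proof (induction \<pi>)
  case (Cons p \<pi>)
  show ?case
  proof (cases "\<pi> = []")
    case True
    then show ?thesis using Cons.prems by (auto simp: descending_def)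
  next
    case False
    then have IH: "descending \<pi>" using Cons by (auto simp: successively_Cons)
    have "gap d p (hd \<pi>)" "snd p \<in> V" "snd (hd \<pi>) \<in> V"
      using Cons.prems False by (auto simp: successively_Cons)
    then have "fst p \<ge> fst (hd \<pi>)" using d[of "snd p" "snd (hd \<pi>)"] by (auto simp: gap_def)
    with IH False show ?thesis
      by (cases \<pi>) (auto simp: descending_def intro: order_trans)
  qed
qed (auto simp: descending_def)

lemma set_layer: "descending \<pi> \<Longrightarrow> snd ` set \<pi> \<subseteq> V \<longleftrightarrow> (\<forall>m. set (layer \<pi> m) \<subseteq> V)"
  by (fastforce simp: layer_def descending_def elim: nonneg_int_cases)

lemma gap_iff_layers:
  assumes d: "\<And>b c. b \<in> V \<Longrightarrow> c \<in> V \<Longrightarrow> 0 \<le> d b c \<and> d b c \<le> 2"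
    and e: "\<And>b. b \<in> V \<Longrightarrow> 0 \<le> e b \<and> e b \<le> (2 :: int)"
  shows "snd ` set \<pi> \<subseteq> V \<and> successively (gap d) \<pi> \<and> (\<pi> \<noteq> [] \<longrightarrow> fst (last \<pi>) \<ge> e (snd (last \<pi>))) \<longleftrightarrow>
    descending \<pi> \<and> (\<forall>m. set (layer \<pi> m) \<subseteq> V \<and> successively (\<lambda>b c. d b c \<le> 0) (layer \<pi> m)) \<and>
    (\<forall>m. layer \<pi> (Suc m) \<noteq> [] \<longrightarrow> layer \<pi> m \<noteq> [] \<longrightarrow>
       d (last (layer \<pi> (Suc m))) (hd (layer \<pi> m)) \<le> 1) \<and>
    (layer \<pi> 0 \<noteq> [] \<longrightarrow> e (last (layer \<pi> 0)) \<le> 0) \<and>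
    (layer \<pi> 0 = [] \<longrightarrow> layer \<pi> 1 \<noteq> [] \<longrightarrow> e (last (layer \<pi> 1)) \<le> 1)"
    (is "?lhs \<longleftrightarrow> descending \<pi> \<and> ?rhs")
proof -
  have "descending \<pi>" if "?lhs"
  proof (rule descendingI[where V = V and d = d])
    assume "\<pi> \<noteq> []"
    then have "snd (last \<pi>) \<in> V" using that by auto
    then show "0 \<le> fst (last \<pi>)" using that e[of "snd (last \<pi>)"] \<open>\<pi> \<noteq> []\<close> by auto
  qed (use that d in auto)
  moreover have "?lhs \<longleftrightarrow> ?rhs" if "descending \<pi>"
  proof -
    obtain N where N: "\<forall>p \<in> set \<pi>. fst p < int N" using bounded_fst by blast
    have asm: "assemble N (layer \<pi>) = \<pi>" using that N by (auto intro: assemble_layer)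
    have nil: "\<forall>m\<ge>N. layer \<pi> m = []" using N by (auto intro: layer_eq_Nil)
    \<comment> \<open>The bounds on \<open>d\<close> and \<open>e\<close> are available only for
      colours in \<open>V\<close>. Both sides include this membership, so the equivalence then holds
      for every descending list.\<close>
    have "?lhs \<longleftrightarrow> ?rhs" if V: "\<And>m. set (layer \<pi> m) \<subseteq> V"
    proof -
      have 1: "(\<forall>m<N. successively (\<lambda>b c. d b c \<le> 0) (layer \<pi> m)) \<longleftrightarrow>
        (\<forall>m. successively (\<lambda>b c. d b c \<le> 0) (layer \<pi> m))"
        using nil by (metis not_le successively.simps(1))
      have 2: "(\<forall>m. Suc m < N \<longrightarrow> layer \<pi> (Suc m) \<noteq> [] \<longrightarrow> P m) \<longleftrightarrow>
        (\<forall>m. layer \<pi> (Suc m) \<noteq> [] \<longrightarrow> P m)" for P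
        using nil by (metis not_le)
      have 3: "snd ` set \<pi> \<subseteq> V" using V set_layer[OF \<open>descending \<pi>\<close>] by blast
      show ?thesis
        using successively_assemble[where V = V and d = d and L = "layer \<pi>" and N = N, OF d V]
          last_assemble_bound[where V = V and e = e and L = "layer \<pi>" and N = N, OF _ V nil] e V 3
        unfolding asm 1 2 by blast
    qed
    then show ?thesis using set_layer[OF that, of V] by blast
  qed
  ultimately show ?thesis by blast
qed

section \<open>Grounded partitions by layers\<close>

text \<open>
  The requirement that the part before the final one is not \<open>0\<close> of ground colour is absorbed into the
  gap to the final part; it then agrees with the gap to the colour at infinity for \<^term>\<open>\<rho>\<close>.
\<close>

definition end_gap :: "nat \<Rightarrow> vertex \<Rightarrow> int" where
  "end_gap i b = (if b = ground i then 1 else H (ground i) b)"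

text \<open>The common form of both families, without the final part and the wrapper
  \<open>Colour\<close>; only the colour set \<open>V\<close> and the gap function \<open>d\<close>
  distinguish them.\<close>

definition stripped :: "vertex set \<Rightarrow> (vertex \<Rightarrow> vertex \<Rightarrow> int) \<Rightarrow> nat \<Rightarrow> (int \<times> vertex) list set" where
  "stripped V d i = {\<tau>. snd ` set \<tau> \<subseteq> V \<and> successively (gap d) \<tau> \<and>
     (\<tau> \<noteq> [] \<longrightarrow> fst (last \<tau>) \<ge> end_gap i (snd (last \<tau>)))}"

definition coloured :: "(int \<times> vertex) list \<Rightarrow> coloured_int list" where
  "coloured = map (map_prod id Colour)"

text \<open>Between two genuine colours \<^term>\<open>\<rho>\<close> does not depend on its index, so 0 is arbitrary here.\<close>

abbreviation \<rho>_gap :: "vertex \<Rightarrow> vertex \<Rightarrow> int" where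
  "\<rho>_gap b c \<equiv> \<rho> 0 (Colour b) (Colour c)"

definition close :: "nat \<Rightarrow> (int \<times> vertex) list \<Rightarrow> coloured_int list" where
  "close i \<tau> = coloured \<tau> @ [(0, Colour (ground i))]"

lemma ground_in_crystal: "i \<le> n \<Longrightarrow> ground i \<in> crystal n"
  by (auto simp: ground_def letters_def)

lemma inj_coloured: "inj coloured"
  unfolding coloured_def by (auto intro!: inj_mapI prod.inj_map simp: inj_def)

lemma inj_close: "inj (close i)"
  using inj_coloured by (auto simp: inj_def close_def)

lemma coloured_surj:
  assumes "snd ` set \<pi> \<subseteq> Colour ` V"
  obtains \<tau> where "\<pi> = coloured \<tau>" "snd ` set \<tau> \<subseteq> V"
proof
  let ?\<tau> = "map (map_prod id (inv Colour)) \<pi>"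
  have "map_prod id (Colour \<circ> inv Colour) p = p" "inv Colour (snd p) \<in> V" if p: "p \<in> set \<pi>" for p
  proof -
    obtain v where "snd p = Colour v" "v \<in> V" using assms p by auto
    moreover have "inv Colour (Colour v) = v" by (rule inv_f_f) (auto simp: inj_def)
    ultimately show "map_prod id (Colour \<circ> inv Colour) p = p" "inv Colour (snd p) \<in> V"
      by (cases p; simp)+
  qed
  then show "\<pi> = coloured ?\<tau>" "snd ` set ?\<tau> \<subseteq> V"
    by (auto simp: coloured_def map_prod.comp intro!: map_idI[symmetric])
qed

text \<open>The energy of a ground colour with itself is 0, so excluding size 0 raises the bound for
  that colour to 1.\<close>

lemma gap_end_iff:
  "(k \<noteq> 0 \<or> b \<noteq> ground i) \<and> H (ground i) b \<le> k \<longleftrightarrow> end_gap i b \<le> k"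
proof -
  have "H (ground i) (ground i) = 0" by (auto simp: ground_def H.simps(4))
  then show ?thesis by (auto simp: end_gap_def)
qed

lemma grounded_partitions_eq:
  assumes "i \<le> n"
  shows "grounded_partitions n i = close i ` stripped (crystal n) (\<lambda>b c. H c b) i"
proof -
  have iff: "close i \<tau> \<in> grounded_partitions n i \<longleftrightarrow> \<tau> \<in> stripped (crystal n) (\<lambda>b c. H c b) i" for \<tau>
  proof -
    let ?d = "\<lambda>b c. H c b" and ?\<sigma> = "\<tau> @ [(0, ground i)]"
    have cl: "close i \<tau> = map (map_prod id Colour) ?\<sigma>" by (simp add: close_def coloured_def)
    have 1: "(\<forall>j k b k' b'. Suc j < length (close i \<tau>) \<longrightarrow> close i \<tau> ! j = (k, Colour b) \<longrightarrow>
        close i \<tau> ! Suc j = (k', Colour b') \<longrightarrow> k - k' \<ge> H b' b) \<longleftrightarrow> successively (gap ?d) ?\<sigma>"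
      unfolding cl successively_conv_nth gap_def
      by (auto simp del: map_append simp: nth_map map_prod_def split_beta prod_eq_iff)
    have 2: "(length (close i \<tau>) > 1 \<longrightarrow> close i \<tau> ! (length (close i \<tau>) - 2) \<noteq> (0, Colour (ground i))) \<longleftrightarrow>
      (\<tau> \<noteq> [] \<longrightarrow> last \<tau> \<noteq> (0, ground i))"
      by (cases "\<tau> = []") (auto simp: close_def coloured_def nth_append last_conv_nth map_prod_def split_beta prod_eq_iff)
    have 3: "(\<forall>p \<in> set (close i \<tau>). snd p \<in> Colour ` crystal n) \<longleftrightarrow> snd ` set \<tau> \<subseteq> crystal n"
      using ground_in_crystal[OF assms] by (auto simp: close_def coloured_def)
    have 4: "close i \<tau> \<noteq> []" "last (close i \<tau>) = (0, Colour (ground i))"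
      by (auto simp: close_def)
    have 5: "(\<tau> \<noteq> [] \<longrightarrow> last \<tau> \<noteq> (0, ground i)) \<and> successively (gap ?d) ?\<sigma> \<longleftrightarrow>
      successively (gap ?d) \<tau> \<and> (\<tau> \<noteq> [] \<longrightarrow> fst (last \<tau>) \<ge> end_gap i (snd (last \<tau>)))"
      using gap_end_iff[of "fst (last \<tau>)" "snd (last \<tau>)" i]
      by (auto simp: successively_append_iff gap_def prod_eq_iff)
    show ?thesis
      unfolding grounded_partitions_def stripped_def mem_Collect_eq 1 2 3 using 4 5 by blast
  qed
  have "\<exists>\<tau>. \<pi> = close i \<tau>" if \<pi>: "\<pi> \<in> grounded_partitions n i" for \<pi>
  proof -
    have "snd ` set (butlast \<pi>) \<subseteq> Colour ` crystal n"
      using \<pi> by (auto simp: grounded_partitions_def dest: in_set_butlastD)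
    then obtain \<tau> where "butlast \<pi> = coloured \<tau>" by (rule coloured_surj)
    moreover have "\<pi> = butlast \<pi> @ [(0, Colour (ground i))]"
      using \<pi> append_butlast_last_id[of \<pi>] by (auto simp: grounded_partitions_def)
    ultimately show ?thesis by (auto simp: close_def)
  qed
  with iff show ?thesis by (auto simp: image_iff) metis
qed

lemma S_colours_eq: "S_colours n = Colour ` (crystal n - {Empty})"
  by (auto simp: S_colours_def crystal_def)

lemma \<rho>_partitions_eq:
  "\<rho>_partitions n i = close i ` stripped (crystal n - {Empty}) \<rho>_gap i"
proof -
  have \<rho>_indep: "\<rho> i (Colour b) (Colour c) = \<rho>_gap b c" if "b \<noteq> Empty" "c \<noteq> Empty" for b c
    using that by (cases b; cases c) auto
  have \<rho>_end: "\<rho> i (Colour b) Colour_infinity = end_gap i b" if "b \<noteq> Empty" for b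
    using that by (cases b) (auto simp: end_gap_def)
  have iff: "coloured \<tau> @ [(0, Colour_infinity)] \<in> \<rho>_partitions_infinity n i \<longleftrightarrow>
      \<tau> \<in> stripped (crystal n - {Empty}) \<rho>_gap i" for \<tau>
  proof -
    let ?\<pi> = "coloured \<tau> @ [(0, Colour_infinity)]"
    let ?P = "\<lambda>p q. fst p - fst q \<ge> \<rho> i (snd p) (snd q)"
    have 1: "(\<forall>j. Suc j < length ?\<pi> \<longrightarrow> snd (?\<pi> ! j) \<in> S_colours n) \<longleftrightarrow> snd ` set \<tau> \<subseteq> crystal n - {Empty}"
      by (fastforce simp: S_colours_eq coloured_def nth_append in_set_conv_nth)
    have 2: "(\<forall>j. Suc j < length ?\<pi> \<longrightarrow> ?P (?\<pi> ! j) (?\<pi> ! Suc j)) \<longleftrightarrow> successively ?P ?\<pi>"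
      by (simp add: successively_conv_nth)
    \<comment> \<open>The colours must be known first, since \<open>\<rho>\<close> is
      \<open>undefined\<close> when its first colour is \<open>Empty\<close>.\<close>
    have "successively ?P ?\<pi> \<longleftrightarrow> successively (gap \<rho>_gap) \<tau> \<and>
        (\<tau> \<noteq> [] \<longrightarrow> fst (last \<tau>) \<ge> end_gap i (snd (last \<tau>)))"
      if V: "snd ` set \<tau> \<subseteq> crystal n - {Empty}"
    proof -
      have "successively ?P (coloured \<tau>) \<longleftrightarrow> successively (\<lambda>p q. ?P (map_prod id Colour p) (map_prod id Colour q)) \<tau>"
        by (simp add: coloured_def successively_map)
      also have "\<dots> \<longleftrightarrow> successively (gap \<rho>_gap) \<tau>"
      proof (rule successively_cong)
        fix p q assume "p \<in> set \<tau>" "q \<in> set \<tau>"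
        then have "snd p \<noteq> Empty" "snd q \<noteq> Empty" using V by auto
        then show "?P (map_prod id Colour p) (map_prod id Colour q) \<longleftrightarrow> gap \<rho>_gap p q"
          by (simp add: gap_def \<rho>_indep)
      qed simp
      moreover have "?P (last (coloured \<tau>)) (0, Colour_infinity) \<longleftrightarrow> fst (last \<tau>) \<ge> end_gap i (snd (last \<tau>))"
        if "\<tau> \<noteq> []"
      proof -
        have "snd (last \<tau>) \<noteq> Empty" using V last_in_set[OF that] by auto
        then show ?thesis using that by (simp add: coloured_def last_map \<rho>_end)
      qed
      moreover have "coloured \<tau> = [] \<longleftrightarrow> \<tau> = []" by (simp add: coloured_def)
      ultimately show ?thesis by (auto simp: successively_append_iff)
    qed
    then show ?thesis
      unfolding \<rho>_partitions_infinity_def stripped_def mem_Collect_eq 1 2 by auto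
  qed
  have "\<exists>\<tau>. \<pi> = coloured \<tau> @ [(0, Colour_infinity)]" if \<pi>: "\<pi> \<in> \<rho>_partitions_infinity n i" for \<pi>
  proof -
    have "snd (butlast \<pi> ! j) \<in> Colour ` (crystal n - {Empty})" if "j < length (butlast \<pi>)" for j
      using \<pi> that by (auto simp: \<rho>_partitions_infinity_def S_colours_eq nth_butlast)
    then have "snd ` set (butlast \<pi>) \<subseteq> Colour ` (crystal n - {Empty})"
      by (force simp: in_set_conv_nth)
    then obtain \<tau> where "butlast \<pi> = coloured \<tau>" by (rule coloured_surj)
    moreover have "\<pi> = butlast \<pi> @ [(0, Colour_infinity)]"
      using \<pi> append_butlast_last_id[of \<pi>] by (auto simp: \<rho>_partitions_infinity_def)
    ultimately show ?thesis by metis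
  qed
  with iff have "\<rho>_partitions_infinity n i =
      (\<lambda>\<tau>. coloured \<tau> @ [(0, Colour_infinity)]) ` stripped (crystal n - {Empty}) \<rho>_gap i"
    by (auto simp: image_iff) metis
  then show ?thesis
    by (simp add: \<rho>_partitions_def image_image close_def)
qed

text \<open>Letters suffice between neighbouring layers, but the end condition in size 0 depends on
  the colour itself. In the last clause \<open>Unbarred i\<close> is the left letter of
  \<open>ground i\<close>; \<open>i = 0\<close> is exempt because \<open>Empty\<close> has no
  letters.\<close>

definition linked :: "nat \<Rightarrow> (nat \<Rightarrow> vertex list) \<Rightarrow> bool" where
  "linked i L \<longleftrightarrow>
     (\<forall>m y x. bottom_letter (L (Suc m)) = Some y \<longrightarrow> top_letter (L m) = Some x \<longrightarrow> x < y) \<and>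
     (L 0 \<noteq> [] \<longrightarrow> end_gap i (last (L 0)) \<le> 0) \<and>
     (L 0 = [] \<longrightarrow> (\<forall>y. bottom_letter (L 1) = Some y \<longrightarrow> i = 0 \<or> Unbarred i < y))"

lemma H_bounds: "0 \<le> H b c \<and> H b c \<le> 2"
  by (cases b; cases c) (auto simp: H.simps(4) of_bool_def)

lemma end_gap_bounds: "0 \<le> end_gap i b \<and> end_gap i b \<le> 2"
  using H_bounds by (auto simp: end_gap_def)

lemma \<rho>_gap_bounds: "b \<noteq> Empty \<Longrightarrow> c \<noteq> Empty \<Longrightarrow> 0 \<le> \<rho>_gap b c \<and> \<rho>_gap b c \<le> 2"
  by (cases b; cases c) (auto simp: of_bool_def)

text \<open>If \<open>x < y\<close> and both indicators of \<open>H\<close> are 1, the correction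
  lowers the sum to 1. If \<open>y \<le> x\<close>, the order inside each colour makes both
  indicators 1 and the correction 0. The exceptional case behaves alike because no letter is its own
  bar.\<close>

lemma H_le_1_iff:
  assumes "b \<in> crystal n" "c \<in> crystal n"
  shows "H c b \<le> 1 \<longleftrightarrow> (\<forall>y x. right_letter b = Some y \<longrightarrow> left_letter c = Some x \<longrightarrow> x < y)"
  using assms by (cases b; cases c) (auto simp: H.simps(4) of_bool_def)

lemma \<rho>_gap_le_1_iff:
  assumes "b \<in> crystal n - {Empty}" "c \<in> crystal n - {Empty}"
  shows "\<rho>_gap b c \<le> 1 \<longleftrightarrow> (\<forall>y x. right_letter b = Some y \<longrightarrow> left_letter c = Some x \<longrightarrow> x < y)"
  using assms by (cases b; cases c) (auto simp: of_bool_def)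

lemma \<rho>_gap_le_0_iff:
  assumes "b \<in> crystal n - {Empty}" "c \<in> crystal n - {Empty}"
  shows "\<rho>_gap b c \<le> 0 \<longleftrightarrow> strictly_above b c"
  using assms by (cases b; cases c) (auto simp: of_bool_def)

text \<open>For \<open>b = ground i\<close> the gap is 1 by definition, and the letter test succeeds
  since \<open>Unbarred i < Barred i\<close>. For \<open>i = 0\<close> energies with
  \<open>Empty\<close> are at most 1.\<close>

lemma end_gap_le_1_iff:
  assumes "b \<in> crystal n" "i \<le> n"
  shows "end_gap i b \<le> 1 \<longleftrightarrow> (\<forall>y. right_letter b = Some y \<longrightarrow> i = 0 \<or> Unbarred i < y)"
proof (cases "b = ground i \<or> i = 0")
  case True
  then show ?thesis
    by (cases b) (auto simp: end_gap_def ground_def)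
next
  case False
  then show ?thesis
    using H_le_1_iff[OF assms(1) ground_in_crystal[OF assms(2)]]
    by (auto simp: end_gap_def) (auto simp: ground_def)
qed

text \<open>The assumption on gaps at most 1 is the same letter comparison for \<open>H\<close> and
  \<open>\<rho>\<close>. Hence both families share \<open>linked\<close> and differ only in the
  layers they admit.\<close>

lemma stripped_iff_layers:
  assumes d: "\<And>b c. b \<in> V \<Longrightarrow> c \<in> V \<Longrightarrow> 0 \<le> d b c \<and> d b c \<le> 2"
    and d1: "\<And>b c. b \<in> V \<Longrightarrow> c \<in> V \<Longrightarrow>
      d b c \<le> 1 \<longleftrightarrow> (\<forall>y x. right_letter b = Some y \<longrightarrow> left_letter c = Some x \<longrightarrow> x < y)"
    and V: "V \<subseteq> crystal n" and i: "i \<le> n"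
  shows "\<tau> \<in> stripped V d i \<longleftrightarrow> descending \<tau> \<and>
    (\<forall>m. layer \<tau> m \<in> {D. set D \<subseteq> V \<and> successively (\<lambda>b c. d b c \<le> 0) D}) \<and> linked i (layer \<tau>)"
proof -
  have link: "(C \<noteq> [] \<longrightarrow> D \<noteq> [] \<longrightarrow> d (last C) (hd D) \<le> 1) \<longleftrightarrow>
    (\<forall>y x. bottom_letter C = Some y \<longrightarrow> top_letter D = Some x \<longrightarrow> x < y)"
    if "set C \<subseteq> V" "set D \<subseteq> V" for C D
  proof (cases "C = [] \<or> D = []")
    case False
    then have "last C \<in> V" "hd D \<in> V" using that by auto
    with d1 False show ?thesis by (auto simp: bottom_letter_def top_letter_def)
  qed (auto simp: bottom_letter_def top_letter_def)
  have fin: "(C \<noteq> [] \<longrightarrow> end_gap i (last C) \<le> 1) \<longleftrightarrow>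
    (\<forall>y. bottom_letter C = Some y \<longrightarrow> i = 0 \<or> Unbarred i < y)" if "set C \<subseteq> V" for C
  proof (cases "C = []")
    case False
    then have "last C \<in> crystal n" using that V last_in_set[OF False] by blast
    from end_gap_le_1_iff[OF this i] False show ?thesis by (auto simp: bottom_letter_def)
  qed (auto simp: bottom_letter_def)
  have "\<tau> \<in> stripped V d i \<longleftrightarrow> descending \<tau> \<and>
    (\<forall>m. set (layer \<tau> m) \<subseteq> V \<and> successively (\<lambda>b c. d b c \<le> 0) (layer \<tau> m)) \<and>
    (\<forall>m. layer \<tau> (Suc m) \<noteq> [] \<longrightarrow> layer \<tau> m \<noteq> [] \<longrightarrow>
       d (last (layer \<tau> (Suc m))) (hd (layer \<tau> m)) \<le> 1) \<and>
    (layer \<tau> 0 \<noteq> [] \<longrightarrow> end_gap i (last (layer \<tau> 0)) \<le> 0) \<and>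
    (layer \<tau> 0 = [] \<longrightarrow> layer \<tau> 1 \<noteq> [] \<longrightarrow> end_gap i (last (layer \<tau> 1)) \<le> 1)"
    unfolding stripped_def mem_Collect_eq by (rule gap_iff_layers[OF d end_gap_bounds])
  also have "\<dots> \<longleftrightarrow> descending \<tau> \<and>
    (\<forall>m. layer \<tau> m \<in> {D. set D \<subseteq> V \<and> successively (\<lambda>b c. d b c \<le> 0) D}) \<and> linked i (layer \<tau>)"
  proof (cases "\<forall>m. set (layer \<tau> m) \<subseteq> V")
    case True
    then show ?thesis
      unfolding linked_def mem_Collect_eq using link[of "layer \<tau> (Suc _)" "layer \<tau> _"] fin[of "layer \<tau> 1"]
      by simp
  qed auto
  finally show ?thesis .
qed

lemma strict_layers_eq:
  "strict_layers n = {D. set D \<subseteq> crystal n - {Empty} \<and> successively (\<lambda>b c. \<rho>_gap b c \<le> 0) D}"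
proof -
  have "successively (\<lambda>b c. \<rho>_gap b c \<le> 0) D \<longleftrightarrow> successively strictly_above D"
    if "set D \<subseteq> crystal n - {Empty}" for D
    using that by (intro successively_cong) (auto simp: \<rho>_gap_le_0_iff[of _ n] subset_iff)
  then show ?thesis unfolding strict_layers_def by blast
qed

definition layerings :: "vertex list set \<Rightarrow> nat \<Rightarrow> (nat \<Rightarrow> vertex list) set" where
  "layerings \<L> i = {L. finite_support L \<and> (\<forall>m. L m \<in> \<L>) \<and> linked i L}"

lemma bij_betw_layer_restrict:
  assumes "\<And>\<pi>. \<pi> \<in> A \<longleftrightarrow> descending \<pi> \<and> P (layer \<pi>)"
  shows "bij_betw layer A {L. finite_support L \<and> P L}"
proof -
  have "A = {\<pi>. descending \<pi> \<and> P (layer \<pi>)}" using assms by blast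
  moreover have "layer ` {\<pi>. descending \<pi> \<and> P (layer \<pi>)} = {L. finite_support L \<and> P L}"
    using bij_betw_imp_surj_on[OF bij_betw_layer] by (auto simp: image_iff set_eq_iff) metis+
  ultimately show ?thesis
    by (intro bij_betw_subset[OF bij_betw_layer]) auto
qed

lemma stripped_H_iff:
  assumes "i \<le> n"
  shows "\<tau> \<in> stripped (crystal n) (\<lambda>b c. H c b) i \<longleftrightarrow>
    descending \<tau> \<and> (\<forall>m. layer \<tau> m \<in> H_layers n) \<and> linked i (layer \<tau>)"
  unfolding H_layers_def
  by (rule stripped_iff_layers[where n = n]) (simp_all add: assms H_bounds H_le_1_iff[of _ n])

lemma stripped_\<rho>_iff:
  assumes "i \<le> n"
  shows "\<tau> \<in> stripped (crystal n - {Empty}) \<rho>_gap i \<longleftrightarrow>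
    descending \<tau> \<and> (\<forall>m. layer \<tau> m \<in> strict_layers n) \<and> linked i (layer \<tau>)"
  unfolding strict_layers_eq
  by (rule stripped_iff_layers[where n = n])
    (use assms \<rho>_gap_bounds \<rho>_gap_le_1_iff[of _ n] in \<open>simp_all add: Diff_subset\<close>)

lemma bij_betw_layer_H:
  assumes "i \<le> n"
  shows "bij_betw layer (stripped (crystal n) (\<lambda>b c. H c b) i) (layerings (H_layers n) i)"
  unfolding layerings_def by (rule bij_betw_layer_restrict) (rule stripped_H_iff[OF assms])

lemma bij_betw_layer_\<rho>:
  assumes "i \<le> n"
  shows "bij_betw layer (stripped (crystal n - {Empty}) \<rho>_gap i) (layerings (strict_layers n) i)"
  unfolding layerings_def by (rule bij_betw_layer_restrict) (rule stripped_\<rho>_iff[OF assms])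

section \<open>Ordinary partitions as multiplicities\<close>

definition multiplicities :: "nat list \<Rightarrow> nat \<Rightarrow> unit list" where
  "multiplicities \<nu> = layer (map (\<lambda>k. (int k, ())) \<nu>)"

lemma bij_betw_multiplicities:
  "bij_betw multiplicities partitions {F. finite_support F \<and> F 0 = []}"
proof -
  let ?A = "{\<pi> :: (int \<times> unit) list. descending \<pi> \<and> layer \<pi> 0 = []}"
  have "bij_betw (map (\<lambda>k. (int k, ()))) partitions ?A"
  proof (rule bij_betw_byWitness[where f' = "map (nat \<circ> fst)"])
    show "map (\<lambda>k. (int k, ())) ` partitions \<subseteq> ?A"
      by (fastforce simp: partitions_def descending_def layer_def filter_empty_conv sorted_wrt_map)
    show "map (nat \<circ> fst) ` ?A \<subseteq> partitions"
    proof clarify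
      fix \<pi> :: "(int \<times> unit) list" assume *: "descending \<pi>" "layer \<pi> 0 = []"
      have "sorted_wrt (\<lambda>x y. nat (fst y) \<le> nat (fst x)) \<pi>"
        using * by (auto simp: descending_def sorted_wrt_map elim!: sorted_wrt_mono_rel[rotated])
      moreover have "fst p > 0" if "p \<in> set \<pi>" for p
        using * that by (force simp: descending_def layer_def filter_empty_conv order_less_le)
      ultimately show "map (nat \<circ> fst) \<pi> \<in> partitions"
        by (auto simp: partitions_def sorted_wrt_map)
    qed
  qed (auto simp: descending_def comp_def intro!: map_idI)
  moreover have "bij_betw layer ?A {F. finite_support F \<and> F 0 = []}"
    by (rule bij_betw_layer_restrict) auto
  ultimately have "bij_betw (layer \<circ> map (\<lambda>k. (int k, ()))) partitions {F. finite_support F \<and> F 0 = []}"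
    by (rule bij_betw_trans)
  moreover have "layer \<circ> map (\<lambda>k. (int k, ())) = multiplicities"
    by (auto simp: multiplicities_def fun_eq_iff)
  ultimately show ?thesis by simp
qed

text \<open>The end condition allows \<open>ground i\<close> to be appended to the layer. In the
  decomposition of the longer layer all ground colours equal this last one, and
  \<open>last D\<close> differs from it, so \<open>D\<close> contains none.\<close>

lemma bottom_layer_not_neutral:
  assumes "D \<in> H_layers n" "D \<noteq> []" "end_gap i (last D) \<le> 0" "i \<le> n"
  shows "\<forall>v \<in> set D. \<not> neutral v"
proof -
  have neutral: "neutral (ground i)" by (auto simp: ground_def)
  have fin: "last D \<noteq> ground i" "H_above (last D) (ground i)"
    using assms(3) by (auto simp: end_gap_def split: if_splits)
  have "D @ [ground i] \<in> H_layers n"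
    using assms fin ground_in_crystal[OF assms(4)]
    by (auto simp: H_layers_def successively_append_iff)
  then obtain A B b g where *: "D @ [ground i] = A @ replicate g b @ B" "frame n A B"
    by (rule H_layers_cases)
  have A: "\<forall>v \<in> set A. \<not> neutral v" and B: "\<forall>v \<in> set B. \<not> neutral v"
    using *(2) upper_not(1) lower_not(1) unfolding frame_def by blast+
  have "B = []"
  proof (rule ccontr)
    assume "B \<noteq> []"
    then have "ground i = last B" using arg_cong[OF *(1), of last] by simp
    with B \<open>B \<noteq> []\<close> neutral show False by auto
  qed
  show ?thesis
  proof (cases g)
    case 0
    then have "ground i \<in> set A" using * \<open>B = []\<close> by (metis append_Nil2 in_set_conv_decomp replicate_0)
    with A neutral show ?thesis by blast
  next
    case (Suc g')
    then have "D @ [ground i] = (A @ replicate g' b) @ [b]"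
      using * \<open>B = []\<close> by (simp add: replicate_append_same)
    then have D: "D = A @ replicate g' b" "b = ground i" by auto
    have "g' = 0" using fin(1) D by (cases g') (auto simp: last_append split: if_splits)
    with A D show ?thesis by simp
  qed
qed

section \<open>Thinning all layers at once\<close>

lemma thin_not_neutral_eq: "\<forall>v \<in> set D. \<not> neutral v \<Longrightarrow> thin D = (D, 0)"
  by (simp add: thin_def filter_empty_conv)

text \<open>For size 0 the layers themselves must agree, because the end condition looks at the last
  colour and not only at its letter.\<close>

lemma linked_cong:
  assumes "\<And>m. top_letter (L m) = top_letter (M m)" "\<And>m. bottom_letter (L m) = bottom_letter (M m)"
    "L 0 = M 0"
  shows "linked i L \<longleftrightarrow> linked i M"
  unfolding linked_def using assms by simp

definition thin_layers :: "(nat \<Rightarrow> vertex list) \<Rightarrow> (nat \<Rightarrow> vertex list) \<times> (nat \<Rightarrow> unit list)" where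
  "thin_layers L = (\<lambda>m. fst (thin (L m)), \<lambda>m. replicate (snd (thin (L m))) ())"

definition thick_layers :: "(nat \<Rightarrow> vertex list) \<times> (nat \<Rightarrow> unit list) \<Rightarrow> nat \<Rightarrow> vertex list" where
  "thick_layers = (\<lambda>(M, F) m. thick (M m, length (F m)))"

lemma thick_letters:
  assumes "C \<in> strict_layers n"
  shows "top_letter (thick (C, f)) = top_letter C" "bottom_letter (thick (C, f)) = bottom_letter C"
  using thin_top_letter[OF thin_thick(1)[OF assms, of f]]
    thin_bottom_letter[OF thin_thick(1)[OF assms, of f]] thin_thick(2)[OF assms, of f] by auto

lemma thick_zero: "C \<in> strict_layers n \<Longrightarrow> thick (C, 0) = C"
  using thin_zero[OF thin_thick(1), of C n 0] thin_thick(2)[of C n 0] by simp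

lemma bij_betw_thin_layers:
  assumes "i \<le> n"
  shows "bij_betw thin_layers (layerings (H_layers n) i)
    (layerings (strict_layers n) i \<times> {F. finite_support F \<and> F 0 = []})"
proof (rule bij_betw_byWitness[where f' = thick_layers])
  have thin_Nil: "thin [] = ([], 0)" by (simp add: thin_def)
  have unit: "replicate (length xs) () = xs" for xs by (induction xs) auto
  show "\<forall>L \<in> layerings (H_layers n) i. thick_layers (thin_layers L) = L"
    by (auto simp: layerings_def thick_layers_def thin_layers_def thick_thin[of _ n] fun_eq_iff)
  show "\<forall>x \<in> layerings (strict_layers n) i \<times> {F. finite_support F \<and> F 0 = []}.
      thin_layers (thick_layers x) = x"
    by (auto simp: layerings_def thick_layers_def thin_layers_def thin_thick[of _ n] fun_eq_iff unit)
  show "thin_layers ` layerings (H_layers n) i \<subseteq>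
    layerings (strict_layers n) i \<times> {F. finite_support F \<and> F 0 = []}"
  proof (rule image_subsetI)
    fix L assume L: "L \<in> layerings (H_layers n) i"
    then have H: "L m \<in> H_layers n" for m by (auto simp: layerings_def)
    \<comment> \<open>Ground colours are absent from size 0, so layer 0 is kept and the ordinary
      partition receives no part 0.\<close>
    have "\<forall>v \<in> set (L 0). \<not> neutral v"
      using bottom_layer_not_neutral[OF H[of 0] _ _ assms] L
      by (cases "L 0 = []") (auto simp: layerings_def linked_def)
    then have 0: "thin (L 0) = (L 0, 0)" by (rule thin_not_neutral_eq)
    have "linked i (\<lambda>m. fst (thin (L m))) \<longleftrightarrow> linked i L"
      using 0 by (intro linked_cong) (auto simp: thin_top_letter[OF H] thin_bottom_letter[OF H])
    moreover have "finite_support (\<lambda>m. fst (thin (L m)))"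
      "finite_support (\<lambda>m. replicate (snd (thin (L m))) ())"
      using L unfolding layerings_def finite_support_def by (auto simp: thin_Nil) (metis thin_Nil fst_conv snd_conv)+
    ultimately show "thin_layers L \<in> layerings (strict_layers n) i \<times> {F. finite_support F \<and> F 0 = []}"
      using L thin_strict_layers[OF H] 0 by (auto simp: layerings_def thin_layers_def)
  qed
  show "thick_layers ` (layerings (strict_layers n) i \<times> {F. finite_support F \<and> F 0 = []}) \<subseteq>
    layerings (H_layers n) i"
  proof clarify
    fix M and F :: "nat \<Rightarrow> unit list"
    assume M: "M \<in> layerings (strict_layers n) i" and F: "finite_support F" "F 0 = []"
    have R: "M m \<in> strict_layers n" for m using M by (auto simp: layerings_def)
    have "linked i (thick_layers (M, F)) \<longleftrightarrow> linked i M"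
      using F by (intro linked_cong) (auto simp: thick_layers_def thick_letters[OF R] thick_zero[OF R])
    moreover have "finite_support (thick_layers (M, F))"
    proof -
      \<comment> \<open>An empty layer may thicken to copies of \<open>Empty\<close>, so both
        supports have to be exhausted.\<close>
      obtain N N' where "\<forall>m\<ge>N. M m = []" "\<forall>m\<ge>N'. F m = []"
        using M F by (auto simp: finite_support_def layerings_def)
      moreover have "thick ([], 0) = []" by (simp add: thick_def)
      ultimately have "\<forall>m \<ge> max N N'. thick_layers (M, F) m = []"
        by (auto simp: thick_layers_def)
      then show ?thesis unfolding finite_support_def by blast
    qed
    ultimately show "thick_layers (M, F) \<in> layerings (H_layers n) i"
      using M thin_thick(1)[OF R] by (auto simp: layerings_def thick_layers_def)
  qed
qed

section \<open>Size, number of parts and colours\<close>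

lemma weight_close: "weight (close i \<tau>) = sum_list (map fst \<tau>)"
  by (simp add: weight_def close_def coloured_def comp_def)

lemma length_close: "length (close i \<tau>) = Suc (length \<tau>)"
  by (simp add: close_def coloured_def)

text \<open>A neutral \<open>Vertex a (bar a)\<close> in the crystal has
  \<open>a \<le> bar a\<close>, which holds exactly for unbarred \<open>a\<close>;
  \<open>Empty\<close> is \<open>ground 0\<close>.\<close>

lemma ground_iff_neutral:
  assumes "v \<in> crystal n"
  shows "(\<exists>k \<le> n. v = ground k) \<longleftrightarrow> neutral v"
proof
  assume "neutral v"
  then show "\<exists>k \<le> n. v = ground k" using assms
  proof (cases rule: neutral_cases)
    case 1
    then show ?thesis by (auto simp: ground_def)
  next
    case (2 a)
    then obtain k where "a = Unbarred k" by (auto simp: le_bar_self_iff)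
    then show ?thesis using 2 by (auto simp: ground_def letters_def intro!: exI[of _ k])
  qed
qed (auto simp: ground_def)

lemma colour_product_close:
  assumes "snd ` set \<tau> \<subseteq> crystal n" "i \<le> n"
  shows "colour_product n (close i \<tau>) = mset (map Colour (filter (\<lambda>v. \<not> neutral v) (map snd \<tau>)))"
proof -
  have "Colour v \<notin> {Colour (ground k) | k. k \<in> {0..n}} \<longleftrightarrow> \<not> neutral v" if "v \<in> crystal n" for v
    using ground_iff_neutral[OF that] by auto
  then have "filter (\<lambda>c. c \<notin> {Colour (ground k) | k. k \<in> {0..n}}) (map Colour vs) =
    map Colour (filter (\<lambda>v. \<not> neutral v) vs)" if "set vs \<subseteq> crystal n" for vs
    using that by (induction vs) auto
  from this[of "map snd \<tau>"] assms show ?thesis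
    by (auto simp: colour_product_def close_def coloured_def comp_def simp flip: mset_filter mset_map)
qed

lemma filter_assemble_cong:
  assumes "\<And>m. filter P (L m) = filter P (M m)"
  shows "filter P (map snd (assemble N L)) = filter P (map snd (assemble N M))"
  using assms by (induction N) (auto simp: comp_def)

lemma thin_layers_statistics:
  assumes L: "\<And>m. layer \<tau> m \<in> H_layers n" and d: "descending \<tau>" "descending \<tau>'" "descending \<sigma>"
    and eq: "(layer \<tau>', layer \<sigma>) = thin_layers (layer \<tau>)"
  shows "sum_list (map fst \<tau>) = sum_list (map fst \<tau>') + sum_list (map fst \<sigma>)"
    and "length \<tau> = length \<tau>' + length \<sigma>"
    and "filter (\<lambda>v. \<not> neutral v) (map snd \<tau>) = filter (\<lambda>v. \<not> neutral v) (map snd \<tau>')"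
proof -
  obtain N1 where N1: "\<forall>p \<in> set (\<tau> @ \<tau>'). fst p < int N1" using bounded_fst by blast
  obtain N2 where N2: "\<forall>p \<in> set \<sigma>. fst p < int N2" using bounded_fst by blast
  \<comment> \<open>A common bound lets the statistics of all three lists be compared layer by
    layer.\<close>
  define N where "N = max N1 N2"
  have asm: "\<tau> = assemble N (layer \<tau>)" "\<tau>' = assemble N (layer \<tau>')" "\<sigma> = assemble N (layer \<sigma>)"
    using N1 N2 by (force intro!: assemble_layer[symmetric] d simp: N_def)+
  have lay: "layer \<tau>' m = fst (thin (layer \<tau> m))" "layer \<sigma> m = replicate (snd (thin (layer \<tau> m))) ()" for m
    using eq by (auto simp: thin_layers_def)
  have len: "length (layer \<tau> m) = length (layer \<tau>' m) + length (layer \<sigma> m)" for m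
    using thin_length[OF L, of m] by (simp add: lay)
  show "sum_list (map fst \<tau>) = sum_list (map fst \<tau>') + sum_list (map fst \<sigma>)"
    by (subst asm(1), subst asm(2), subst asm(3))
      (simp add: sum_assemble len algebra_simps sum.distrib)
  show "length \<tau> = length \<tau>' + length \<sigma>"
    by (subst asm(1), subst asm(2), subst asm(3)) (simp add: length_assemble len sum.distrib)
  show "filter (\<lambda>v. \<not> neutral v) (map snd \<tau>) = filter (\<lambda>v. \<not> neutral v) (map snd \<tau>')"
    by (subst asm(1), subst asm(2), rule filter_assemble_cong) (simp add: lay thin_not_neutral[OF L])
qed

theorem theorem1p9:
  fixes n i :: nat
  assumes "i \<in> {0..n}"
  shows "\<exists>\<Phi>. bij_betw \<Phi> (grounded_partitions n i) (\<rho>_partitions n i \<times> partitions) \<and>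
    (\<forall>\<pi> \<in> grounded_partitions n i. \<forall>\<mu> \<nu>. \<Phi> \<pi> = (\<mu>, \<nu>) \<longrightarrow>
       weight \<pi> = weight \<mu> + int (sum_list \<nu>) \<and>
       length \<pi> = length \<mu> + length \<nu> \<and>
       colour_product n \<pi> = colour_product n \<mu>)"
proof -
  have i: "i \<le> n" using assms by simp
  let ?A = "stripped (crystal n) (\<lambda>b c. H c b) i" and ?B = "stripped (crystal n - {Empty}) \<rho>_gap i"
  let ?G = "layerings (H_layers n) i" and ?R = "layerings (strict_layers n) i"
  let ?F = "{F :: nat \<Rightarrow> unit list. finite_support F \<and> F 0 = []}"
  have close: "bij_betw (close i) X (close i ` X)" for X
    using inj_close by (auto simp: bij_betw_def intro: inj_on_subset)
  let ?a = "layer \<circ> inv_into ?A (close i)" and ?b = "layer \<circ> inv_into ?B (close i)"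
  have a: "bij_betw ?a (grounded_partitions n i) ?G"
    unfolding grounded_partitions_eq[OF i]
    by (rule bij_betw_trans[OF bij_betw_inv_into[OF close] bij_betw_layer_H[OF i]])
  have b: "bij_betw ?b (\<rho>_partitions n i) ?R"
    unfolding \<rho>_partitions_eq
    by (rule bij_betw_trans[OF bij_betw_inv_into[OF close] bij_betw_layer_\<rho>[OF i]])
  let ?c = "map_prod ?b multiplicities"
  have c: "bij_betw ?c (\<rho>_partitions n i \<times> partitions) (?R \<times> ?F)"
    using b bij_betw_multiplicities unfolding bij_betw_def
    by (auto intro!: map_prod_inj_on map_prod_surj_on)
  define \<Phi> where "\<Phi> = inv_into (\<rho>_partitions n i \<times> partitions) ?c \<circ> (thin_layers \<circ> ?a)"
  have bij: "bij_betw \<Phi> (grounded_partitions n i) (\<rho>_partitions n i \<times> partitions)"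
    unfolding \<Phi>_def
    by (rule bij_betw_trans[OF bij_betw_trans[OF a bij_betw_thin_layers[OF i]] bij_betw_inv_into[OF c]])
  have "weight \<pi> = weight \<mu> + int (sum_list \<nu>) \<and> length \<pi> = length \<mu> + length \<nu> \<and>
       colour_product n \<pi> = colour_product n \<mu>"
    if \<pi>: "\<pi> \<in> grounded_partitions n i" and \<Phi>: "\<Phi> \<pi> = (\<mu>, \<nu>)" for \<pi> \<mu> \<nu>
  proof -
    have \<mu>\<nu>: "\<mu> \<in> \<rho>_partitions n i" "\<nu> \<in> partitions"
      using bij_betwE[OF bij] \<pi> \<Phi> by fastforce+
    obtain \<tau> where \<tau>: "\<pi> = close i \<tau>" "\<tau> \<in> ?A" using \<pi> grounded_partitions_eq[OF i] by auto
    obtain \<tau>' where \<tau>': "\<mu> = close i \<tau>'" "\<tau>' \<in> ?B" using \<mu>\<nu> \<rho>_partitions_eq by auto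
    define \<sigma> where "\<sigma> = map (\<lambda>k. (int k, ())) \<nu>"
    have inv: "inv_into X (close i) (close i x) = x" if "x \<in> X" for X x
      using that inj_close by (metis inv_into_f_f inj_on_subset subset_UNIV)
    have "thin_layers (?a \<pi>) \<in> ?R \<times> ?F"
      using bij_betwE[OF bij_betw_thin_layers[OF i]] bij_betwE[OF a] \<pi> by blast
    \<comment> \<open>The thinned layers lie in the image of \<open>?c\<close>, so \<open>?c\<close>
      undoes the inverse in \<open>\<Phi>\<close> and identifies the layers of \<open>\<mu>\<close>
      and \<open>\<nu>\<close>.\<close>
    then have "?c (\<Phi> \<pi>) = thin_layers (?a \<pi>)"
      unfolding \<Phi>_def comp_apply[of "inv_into _ _"] comp_apply[of thin_layers]
      by (intro f_inv_into_f) (simp add: bij_betw_imp_surj_on[OF c])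
    then have "?c (\<mu>, \<nu>) = thin_layers (?a \<pi>)" by (simp only: \<Phi>)
    then have eq: "(layer \<tau>', layer \<sigma>) = thin_layers (layer \<tau>)"
      by (simp add: \<tau> \<tau>' inv[OF \<tau>(2)] inv[OF \<tau>'(2)] \<sigma>_def multiplicities_def)
    have L: "layer \<tau> m \<in> H_layers n" for m
      using bij_betwE[OF bij_betw_layer_H[OF i]] \<tau>(2) by (auto simp: layerings_def)
    have V: "snd ` set \<tau> \<subseteq> crystal n" "snd ` set \<tau>' \<subseteq> crystal n"
      using \<tau> \<tau>' by (auto simp: stripped_def)
    have "descending \<tau>" "descending \<tau>'"
      using \<tau>(2) \<tau>'(2) stripped_H_iff[OF i] stripped_\<rho>_iff[OF i] by blast+
    moreover have "descending \<sigma>"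
      using \<mu>\<nu>(2) by (auto simp: \<sigma>_def descending_def partitions_def sorted_wrt_map)
    ultimately have stat: "sum_list (map fst \<tau>) = sum_list (map fst \<tau>') + sum_list (map fst \<sigma>)"
      "length \<tau> = length \<tau>' + length \<sigma>"
      "filter (\<lambda>v. \<not> neutral v) (map snd \<tau>) = filter (\<lambda>v. \<not> neutral v) (map snd \<tau>')"
      using thin_layers_statistics[OF L _ _ _ eq] by blast+
    have "sum_list (map fst \<sigma>) = int (sum_list \<nu>)"
      unfolding \<sigma>_def by (induction \<nu>) auto
    with stat show ?thesis
      using colour_product_close[OF V(1) i] colour_product_close[OF V(2) i]
      by (simp add: \<tau>(1) \<tau>'(1) weight_close length_close \<sigma>_def)
  qed
  with bij show ?thesis by blast
qed

end
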